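(* Let $V,W$ be two vector spaces over $\mathbb{K}$, let $f$ and $g$ be linear forms on $V$ and $W$ respectively, and let $\lambda,\mu\in\mathbb{K}$. The Com-PreLie bialgebras $S(V,f,\lambda)$ and $S(W,g,\mu)$ are isomorphic if, and only if, one of the two following assertions holds: 1. $f=g=0$ and $\dim(V)=\dim(W)$. 2. $\lambda=\mu$ and there exists a linear bijection $\psi:V\longrightarrow W$ such that $g\circ\psi=f$.
   Context: $\mathbb{K}$ is a field of characteristic zero. $[k]=\{1,\ldots,k\}$. A Com-PreLie algebra is a vector space $A$ with bilinear products $\cdot,\bullet$ such that $\cdot$ is commutative and associative and, for all $a,b,c\in A$, $(a\bullet b)\bullet c-a\bullet(b\bullet c)=(a\bullet c)\bullet b-a\bullet(c\bullet b)$ and $(a\cdot b)\bullet c=(a\bullet c)\cdot b+a\cdot(b\bullet c)$. A Com-PreLie bialgebra is a family $(A,\cdot,\bullet,\Delta)$ such that $(A,\cdot,\bullet)$ is a Com-PreLie algebra with a unit $1$ for $\cdot$, $(A,\cdot,\Delta)$ is a bialgebra, and $\Delta(a\bullet b)=a^{(1)}\otimes a^{(2)}\bullet b+a^{(1)}\bullet b^{(1)}\otimes a^{(2)}\cdot b^{(2)}$ for all $a,b$. Isomorphisms of Com-PreLie bialgebras are bialgebra isomorphisms compatible with $\bullet$. For a vector space $V$, $f\in V^*$, $\lambda\in\mathbb{K}$, $S(V,f,\lambda)$ is the Com-PreLie bialgebra whose underlying bialgebra is the symmetric algebra $S(V)$ (elements of $V$ primitive), with product $\bullet$ defined by $1\bullet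 x=0$ for $x\in S(V)$; $x\bullet x_1\ldots x_k=\sum_{I\subsetneq[k]}|I|!\lambda^{|I|}f(x)\prod_{i\in I}f(x_i)\prod_{i\notin I}x_i$ for $x,x_1,\ldots,x_k\in V$; and $x_1\ldots x_k\bullet x=\sum_{i=1}^k x_1\ldots(x_i\bullet x)\ldots x_k$ for $x_1,\ldots,x_k\in V$, $x\in S(V)$. *)

theory Defs
  imports Complex_Main "HOL-Library.Poly_Mapping" "HOL-Library.Equipollence"
begin

section \<open>Free vector spaces and quotients\<close>

text \<open>The type \<open>'b \<Rightarrow>\<^sub>0 'k\<close> is the free vector space on the type \<open>'b\<close>;
  \<open>Poly_Mapping.single x 1\<close> is the basis vector given by \<open>x\<close>.\<close>

definition pscale :: "'k::field \<Rightarrow> ('b \<Rightarrow>\<^sub>0 'k) \<Rightarrow> ('b \<Rightarrow>\<^sub>0 'k)"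
  where "pscale c p = Poly_Mapping.map ((*) c) p"

lemma lookup_pscale [simp]:
  "Poly_Mapping.lookup (pscale c p) x = c * Poly_Mapping.lookup p x"
  by (simp add: pscale_def Poly_Mapping.map.rep_eq when_def)

lemma vector_space_pscale: "vector_space pscale"
  by unfold_locales (auto intro!: poly_mapping_eqI simp: lookup_add algebra_simps)

definition lin_ext :: "('b \<Rightarrow> ('c \<Rightarrow>\<^sub>0 'k)) \<Rightarrow> ('b \<Rightarrow>\<^sub>0 'k::field) \<Rightarrow> ('c \<Rightarrow>\<^sub>0 'k)"
  where "lin_ext h p = (\<Sum>x\<in>Poly_Mapping.keys p. pscale (Poly_Mapping.lookup p x) (h x))"

definition bilin_ext ::
  "('a \<Rightarrow> 'b \<Rightarrow> ('c \<Rightarrow>\<^sub>0 'k)) \<Rightarrow> ('a \<Rightarrow>\<^sub>0 'k::field) \<Rightarrow> ('b \<Rightarrow>\<^sub>0 'k) \<Rightarrow> ('c \<Rightarrow>\<^sub>0 'k)"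
  where "bilin_ext h p q = lin_ext (\<lambda>x. lin_ext (h x) q) p"

definition quot_class :: "'a::ab_group_add set \<Rightarrow> 'a \<Rightarrow> 'a set"
  where "quot_class U p = {q. q - p \<in> U}"


section \<open>Com-PreLie bialgebras and their isomorphisms\<close>

record ('a, 'k) vsp =
  carrier :: "'a set"
  add :: "'a \<Rightarrow> 'a \<Rightarrow> 'a"
  smult :: "'k \<Rightarrow> 'a \<Rightarrow> 'a"

text \<open>The tensor product \<open>A \<otimes> A\<close> is the quotient of the free vector space on pairs of elements
  of \<open>A\<close> by the bilinearity relations; its elements are the cosets of \<open>tensor_rel A\<close>
  of the elements supported on \<open>carrier A \<times> carrier A\<close>.\<close>

definition tensor_rel :: "('a, 'k::field, 'z) vsp_scheme \<Rightarrow> (('a \<times> 'a) \<Rightarrow>\<^sub>0 'k) set"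
  where "tensor_rel A = module.span pscale
   ({Poly_Mapping.single (add A a a', b) 1 - Poly_Mapping.single (a, b) 1
       - Poly_Mapping.single (a', b) 1 | a a' b.
       a \<in> carrier A \<and> a' \<in> carrier A \<and> b \<in> carrier A} \<union>
    {Poly_Mapping.single (a, add A b b') 1 - Poly_Mapping.single (a, b) 1
       - Poly_Mapping.single (a, b') 1 | a b b'.
       a \<in> carrier A \<and> b \<in> carrier A \<and> b' \<in> carrier A} \<union>
    {Poly_Mapping.single (smult A c a, b) 1 - Poly_Mapping.single (a, b) c | c a b.
       a \<in> carrier A \<and> b \<in> carrier A} \<union>
    {Poly_Mapping.single (a, smult A c b) 1 - Poly_Mapping.single (a, b) c | c a b.
       a \<in> carrier A \<and> b \<in> carrier A})"

text \<open>The data of a Com-PreLie bialgebra. The values of \<open>comult\<close> are elements of the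
  tensor square, hence cosets of \<open>tensor_rel\<close>.\<close>

record (overloaded) ('a, 'k) cpl_bialgebra = "('a, 'k) vsp" +
  mult :: "'a \<Rightarrow> 'a \<Rightarrow> 'a"
  one :: "'a"
  bullet :: "'a \<Rightarrow> 'a \<Rightarrow> 'a"
  comult :: "'a \<Rightarrow> (('a \<times> 'a) \<Rightarrow>\<^sub>0 'k) set"
  counit :: "'a \<Rightarrow> 'k"

text \<open>The map \<open>\<phi> \<otimes> \<phi>\<close> into the tensor square of \<open>B\<close>. For linear \<open>\<phi>\<close> and a coset \<open>T\<close>,
  all cosets in the union coincide; the same idiom is used for every operation
  on a quotient below.\<close>

definition tensor_map ::
  "('b, 'k::field, 'z) vsp_scheme \<Rightarrow> ('a \<Rightarrow> 'b) \<Rightarrow> (('a \<times> 'a) \<Rightarrow>\<^sub>0 'k) set \<Rightarrow> (('b \<times> 'b) \<Rightarrow>\<^sub>0 'k) set"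
  where "tensor_map B \<phi> T =
    (\<Union>t\<in>T. quot_class (tensor_rel B) (lin_ext (\<lambda>(a, b). Poly_Mapping.single (\<phi> a, \<phi> b) 1) t))"

definition cpl_bialgebra_iso ::
  "('a, 'k::field) cpl_bialgebra \<Rightarrow> ('b, 'k) cpl_bialgebra \<Rightarrow> ('a \<Rightarrow> 'b) \<Rightarrow> bool"
  where "cpl_bialgebra_iso A B \<phi> \<longleftrightarrow>
    bij_betw \<phi> (carrier A) (carrier B) \<and>
    (\<forall>a\<in>carrier A. \<forall>b\<in>carrier A. \<phi> (add A a b) = add B (\<phi> a) (\<phi> b)) \<and>
    (\<forall>c. \<forall>a\<in>carrier A. \<phi> (smult A c a) = smult B c (\<phi> a)) \<and>
    (\<forall>a\<in>carrier A. \<forall>b\<in>carrier A. \<phi> (mult A a b) = mult B (\<phi> a) (\<phi> b)) \<and>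
    \<phi> (one A) = one B \<and>
    (\<forall>a\<in>carrier A. comult B (\<phi> a) = tensor_map B \<phi> (comult A a)) \<and>
    (\<forall>a\<in>carrier A. counit B (\<phi> a) = counit A a) \<and>
    (\<forall>a\<in>carrier A. \<forall>b\<in>carrier A. \<phi> (bullet A a b) = bullet B (\<phi> a) (\<phi> b))"

definition cpl_bialgebra_isomorphic ::
  "('a, 'k::field) cpl_bialgebra \<Rightarrow> ('b, 'k) cpl_bialgebra \<Rightarrow> bool"
  where "cpl_bialgebra_isomorphic A B \<longleftrightarrow> (\<exists>\<phi>. cpl_bialgebra_iso A B \<phi>)"


section \<open>The symmetric algebra\<close>

text \<open>The word \<open>[x\<^sub>1, \<dots>, x\<^sub>k]\<close> stands for the product \<open>x\<^sub>1 \<dots> x\<^sub>k\<close>. The first two families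
  of relations turn the free vector space on words over \<open>V\<close> into the tensor algebra of \<open>V\<close>,
  the third one turns the latter into \<open>S(V)\<close>. The scalar multiplication of \<open>V\<close> is \<open>s\<close>.\<close>

definition sym_rel :: "('k::field \<Rightarrow> 'v::ab_group_add \<Rightarrow> 'v) \<Rightarrow> ('v list \<Rightarrow>\<^sub>0 'k) set"
  where "sym_rel s = module.span pscale
   ({Poly_Mapping.single (p @ (u + v) # q) 1 - Poly_Mapping.single (p @ u # q) 1
       - Poly_Mapping.single (p @ v # q) 1 | p q u v. True} \<union>
    {Poly_Mapping.single (p @ s c v # q) 1 - Poly_Mapping.single (p @ v # q) c | p q c v. True} \<union>
    {Poly_Mapping.single (p @ u # v # q) 1 - Poly_Mapping.single (p @ v # u # q) 1 | p q u v. True})"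

abbreviation sym_class ::
  "('k::field \<Rightarrow> 'v::ab_group_add \<Rightarrow> 'v) \<Rightarrow> ('v list \<Rightarrow>\<^sub>0 'k) \<Rightarrow> ('v list \<Rightarrow>\<^sub>0 'k) set"
  where "sym_class s \<equiv> quot_class (sym_rel s)"

definition word_mult :: "'v list \<Rightarrow> 'v list \<Rightarrow> ('v list \<Rightarrow>\<^sub>0 'k::field)"
  where "word_mult xs ys = Poly_Mapping.single (xs @ ys) 1"

text \<open>The coproduct is the algebra morphism for which all \<open>x\<close> in \<open>V\<close> are primitive:
  \<open>\<Delta>(x\<^sub>1 \<dots> x\<^sub>k) = (x\<^sub>1 \<otimes> 1 + 1 \<otimes> x\<^sub>1) \<dots> (x\<^sub>k \<otimes> 1 + 1 \<otimes> x\<^sub>k)\<close>.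
  The pair \<open>(u, w)\<close> of words stands for \<open>u \<otimes> w\<close>.\<close>

primrec word_comult :: "'v list \<Rightarrow> (('v list \<times> 'v list) \<Rightarrow>\<^sub>0 'k::field)"
  where
    "word_comult [] = Poly_Mapping.single ([], []) 1"
  | "word_comult (x # xs) =
       bilin_ext (\<lambda>(u, u') (w, w'). Poly_Mapping.single (u @ w, u' @ w') 1)
         (Poly_Mapping.single ([x], []) 1 + Poly_Mapping.single ([], [x]) 1) (word_comult xs)"

text \<open>The product of a letter \<open>x\<close> with the word \<open>xs\<close> of length \<open>k\<close>; the positions in \<open>xs\<close> run
  from \<open>0\<close> to \<open>k - 1\<close>, and \<open>nths xs J\<close> is the subword on the positions in \<open>J\<close>.\<close>

definition letter_bullet ::
  "('v \<Rightarrow> 'k::field_char_0) \<Rightarrow> 'k \<Rightarrow> 'v \<Rightarrow> 'v list \<Rightarrow> ('v list \<Rightarrow>\<^sub>0 'k)"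
  where "letter_bullet f lam x xs =
    (\<Sum>I | I \<subset> {..<length xs}.
      Poly_Mapping.single (nths xs ({..<length xs} - I))
        (fact (card I) * lam ^ card I * f x * (\<Prod>i\<in>I. f (xs ! i))))"

definition word_bullet ::
  "('v \<Rightarrow> 'k::field_char_0) \<Rightarrow> 'k \<Rightarrow> 'v list \<Rightarrow> 'v list \<Rightarrow> ('v list \<Rightarrow>\<^sub>0 'k)"
  where "word_bullet f lam xs ys =
    (\<Sum>i<length xs.
      lin_ext (\<lambda>w. Poly_Mapping.single (take i xs @ w @ drop (Suc i) xs) 1)
        (letter_bullet f lam (xs ! i) ys))"

definition sym_vsp ::
  "('k::field \<Rightarrow> 'v::ab_group_add \<Rightarrow> 'v) \<Rightarrow> (('v list \<Rightarrow>\<^sub>0 'k) set, 'k) vsp"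
  where "sym_vsp s =
    \<lparr>carrier = range (sym_class s),
     add = (\<lambda>X Y. \<Union>a\<in>X. \<Union>b\<in>Y. sym_class s (a + b)),
     smult = (\<lambda>c X. \<Union>a\<in>X. sym_class s (pscale c a))\<rparr>"

text \<open>The augmentation \<open>counit\<close> is the coefficient of the empty word, which occurs in no relation.\<close>

definition S_bialgebra ::
  "('k::field_char_0 \<Rightarrow> 'v::ab_group_add \<Rightarrow> 'v) \<Rightarrow> ('v \<Rightarrow> 'k) \<Rightarrow> 'k \<Rightarrow>
    (('v list \<Rightarrow>\<^sub>0 'k) set, 'k) cpl_bialgebra"
  where "S_bialgebra s f lam =
    \<lparr>carrier = carrier (sym_vsp s),
     add = add (sym_vsp s),
     smult = smult (sym_vsp s),
     mult = (\<lambda>X Y. \<Union>a\<in>X. \<Union>b\<in>Y. sym_class s (bilin_ext word_mult a b)),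
     one = sym_class s (Poly_Mapping.single [] 1),
     bullet = (\<lambda>X Y. \<Union>a\<in>X. \<Union>b\<in>Y. sym_class s (bilin_ext (word_bullet f lam) a b)),
     comult = (\<lambda>X. \<Union>a\<in>X. quot_class (tensor_rel (sym_vsp s))
        (lin_ext (\<lambda>(u, w). Poly_Mapping.single
            (sym_class s (Poly_Mapping.single u 1), sym_class s (Poly_Mapping.single w 1)) 1)
          (lin_ext word_comult a))),
     counit = (\<lambda>X. the_elem ((\<lambda>a. Poly_Mapping.lookup a []) ` X))\<rparr>"


section \<open>Dimension\<close>

text \<open>Equality of possibly infinite dimensions. (The library function \<open>dim\<close> is \<open>nat\<close>-valued,
  with value \<open>0\<close> in infinite dimension.)\<close>

definition same_dim ::
  "('k::field \<Rightarrow> 'v::ab_group_add \<Rightarrow> 'v) \<Rightarrow> ('k \<Rightarrow> 'w::ab_group_add \<Rightarrow> 'w) \<Rightarrow> bool"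
  where "same_dim s t \<longleftrightarrow>
    (\<exists>B C. \<not> module.dependent s B \<and> module.span s B = UNIV \<and>
           \<not> module.dependent t C \<and> module.span t C = UNIV \<and> B \<approx> C)"

end

theory Submission
  imports Defs
begin

text \<open>A linear bijection \<open>\<psi>: V \<rightarrow> W\<close> with \<open>g \<circ> \<psi> = f\<close> turns each of the formulas that define
  \<open>S(V,f,\<lambda>)\<close> into the corresponding one for \<open>S(W,g,\<lambda>)\<close>, so \<open>x\<^sub>1 \<dots> x\<^sub>k \<mapsto> \<psi> x\<^sub>1 \<dots> \<psi> x\<^sub>k\<close> is an
  isomorphism (lemma \<open>iso_sym_map\<close>). When \<open>f = g = 0\<close>, every letter acts by zero and \<open>\<lambda>\<close> disappears
  from the formulas; only a linear bijection is then required, and one exists exactly when the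
  dimensions agree (\<open>same_dim_iff\<close>).

  Conversely, let \<open>\<phi>\<close> be an isomorphism. Multiplication after comultiplication acts on the
  degree \<open>n\<close> part of \<open>S(W)\<close> as the scalar \<open>2\<^sup>n\<close>, whereas it doubles a primitive element. In
  characteristic zero \<open>2\<^sup>n = 2\<close> forces \<open>n = 1\<close>, so the primitive elements are the letters
  (\<open>primitive_letter\<close>). Being a coalgebra morphism, \<open>\<phi>\<close> maps letters to letters and restricts
  to a linear map \<open>\<psi>: V \<rightarrow> W\<close>; being an algebra morphism, it is then \<open>S(\<psi>)\<close>, which forces
  \<open>\<psi>\<close> to be bijective (\<open>iso_on_letters\<close>). The parameters are recovered from products of letters
  (\<open>iso_parameters\<close>): \<open>x \<bullet> y = f(x) y\<close> gives \<open>g \<circ> \<psi> = f\<close>, and the degree one part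
  \<open>2 \<lambda> f(x)\<^sup>2 x\<close> of \<open>x \<bullet> (x x)\<close> gives \<open>\<lambda> = \<mu>\<close> as soon as \<open>f(x) \<noteq> 0\<close> for some \<open>x\<close>.

  That last step evaluates the product \<open>\<bullet>\<close> on representatives, so it must be known that
  \<open>\<bullet>\<close> is compatible with the relations of the symmetric algebra. In the left argument this
  holds because \<open>\<bullet>\<close> is a derivation there; in the right argument it follows from a recursion for the
  sum over subsets (\<open>contraction\<close>), which exhibits its symmetry in the first two letters.\<close>

section \<open>Linear maps on a free vector space\<close>

interpretation free: vector_space pscale
  by (rule vector_space_pscale)

text \<open>The target of \<^const>\<open>lin_ext\<close> is a free vector space; a general target is needed to map words
  into \<open>V\<close> itself.\<close>

definition free_lift :: "('k::field \<Rightarrow> 'v::ab_group_add \<Rightarrow> 'v) \<Rightarrow> ('b \<Rightarrow> 'v) \<Rightarrow> ('b \<Rightarrow>\<^sub>0 'k) \<Rightarrow> 'v"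
  where "free_lift s h p = (\<Sum>x\<in>Poly_Mapping.keys p. s (Poly_Mapping.lookup p x) (h x))"

lemma lin_ext_eq_free_lift: "lin_ext h = free_lift pscale h"
  by (simp add: fun_eq_iff lin_ext_def free_lift_def)

text \<open>Identities between linear expressions in free vector spaces are proved by comparing the two sides
  on basis vectors. The rules \<open>linear_intros\<close> discharge the linearity of the two sides in the
  variable being specialised.\<close>

named_theorems linear_intros

lemma linear_free_lift [linear_intros]:
  assumes "vector_space s"
  shows "Vector_Spaces.linear pscale s (free_lift s h)"
proof -
  interpret s: vector_space s by fact
  have superset: "free_lift s h p = (\<Sum>x\<in>S. s (Poly_Mapping.lookup p x) (h x))"
    if "finite S" "Poly_Mapping.keys p \<subseteq> S" for p S
    unfolding free_lift_def
    by (rule sum.mono_neutral_left) (use that in \<open>auto simp: in_keys_iff\<close>)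
  show ?thesis
    unfolding Vector_Spaces.linear_iff
  proof (intro conjI allI)
    fix p q :: "'c \<Rightarrow>\<^sub>0 'a" and c
    let ?S = "Poly_Mapping.keys p \<union> Poly_Mapping.keys q"
    have "free_lift s h (p + q) = (\<Sum>x\<in>?S. s (Poly_Mapping.lookup (p + q) x) (h x))"
      by (rule superset) (auto simp: in_keys_iff lookup_add)
    also have "\<dots> = free_lift s h p + free_lift s h q"
      by (simp add: superset[of ?S p] superset[of ?S q] lookup_add s.scale_left_distrib sum.distrib)
    finally show "free_lift s h (p + q) = free_lift s h p + free_lift s h q" .
    have "free_lift s h (pscale c p) =
        (\<Sum>x\<in>Poly_Mapping.keys p. s (Poly_Mapping.lookup (pscale c p) x) (h x))"
      by (rule superset) (auto simp: in_keys_iff)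
    then show "free_lift s h (pscale c p) = s c (free_lift s h p)"
      by (simp add: free_lift_def s.scale_sum_right)
  qed (simp_all add: assms vector_space_pscale)
qed

lemma linear_lin_ext [linear_intros]: "Vector_Spaces.linear pscale pscale (lin_ext h)"
  by (simp add: lin_ext_eq_free_lift linear_free_lift vector_space_pscale)

lemma linear_add_fun [linear_intros]:
  "Vector_Spaces.linear s t F \<Longrightarrow> Vector_Spaces.linear s t G \<Longrightarrow> Vector_Spaces.linear s t (\<lambda>p. F p + G p)"
  unfolding Vector_Spaces.linear_iff by (auto simp: vector_space_def algebra_simps)

lemma linear_diff_fun [linear_intros]:
  assumes "Vector_Spaces.linear s t F" "Vector_Spaces.linear s t G"
  shows "Vector_Spaces.linear s t (\<lambda>p. F p - G p)"
proof -
  interpret t: vector_space t using assms(1) unfolding Vector_Spaces.linear_iff by blast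
  show ?thesis using assms unfolding Vector_Spaces.linear_iff by (auto simp: algebra_simps t.scale_right_diff_distrib)
qed

lemma linear_scale_fun:
  assumes "Vector_Spaces.linear s t F"
  shows "Vector_Spaces.linear s t (\<lambda>p. t c (F p))"
proof -
  interpret t: vector_space t using assms unfolding Vector_Spaces.linear_iff by blast
  show ?thesis using assms unfolding Vector_Spaces.linear_iff
    by (auto simp: t.scale_right_distrib t.scale_left_commute)
qed

lemmas linear_pscale_fun [linear_intros] = linear_scale_fun[where t = pscale]

lemma linear_zero_fun [linear_intros]:
  "vector_space s \<Longrightarrow> vector_space t \<Longrightarrow> Vector_Spaces.linear s t (\<lambda>p. 0)"
  unfolding Vector_Spaces.linear_iff by (simp add: module.scale_zero_right module_iff_vector_space)

lemma linear_id_fun [linear_intros]: "vector_space s \<Longrightarrow> Vector_Spaces.linear s s (\<lambda>p. p)"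
  unfolding Vector_Spaces.linear_iff by auto

lemma linear_comp_fun:
  "Vector_Spaces.linear s t F \<Longrightarrow> Vector_Spaces.linear t u G \<Longrightarrow> Vector_Spaces.linear s u (\<lambda>p. G (F p))"
  unfolding Vector_Spaces.linear_iff by auto

lemmas linear_lin_ext_comp [linear_intros] = linear_comp_fun[OF _ linear_lin_ext]

declare vector_space_pscale [linear_intros]

lemma linearD:
  assumes "Vector_Spaces.linear s t F"
  shows "F (p + q) = F p + F q" "F (p - q) = F p - F q" "F 0 = 0" "F (s c p) = t c (F p)"
    "F (sum a I) = (\<Sum>i\<in>I. F (a i))"
proof -
  interpret module_hom s t F using assms by (simp add: linear_iff_module_hom)
  show "F (p + q) = F p + F q" "F (p - q) = F p - F q" "F 0 = 0" "F (s c p) = t c (F p)"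
    "F (sum a I) = (\<Sum>i\<in>I. F (a i))"
    by (rule add diff zero scale sum)+
qed

lemmas lin_ext_simps [simp] = linearD[OF linear_lin_ext]

lemma pscale_single [simp]: "pscale c (Poly_Mapping.single x d) = Poly_Mapping.single x (c * d)"
  by (rule poly_mapping_eqI) (simp add: lookup_single when_def)

lemma free_lift_single [simp]:
  assumes "vector_space s" shows "free_lift s h (Poly_Mapping.single x c) = s c (h x)"
proof -
  interpret vector_space s by fact
  show ?thesis by (cases "c = 0") (auto simp: free_lift_def)
qed

lemma lin_ext_single [simp]: "lin_ext h (Poly_Mapping.single x c) = pscale c (h x)"
  by (simp add: lin_ext_eq_free_lift vector_space_pscale)

lemma lin_ext_basis: "lin_ext (\<lambda>x. Poly_Mapping.single x 1) p = p"
  by (rule poly_mapping_eqI)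
    (auto simp: lin_ext_def lookup_sum lookup_single when_def if_distrib sum.delta in_keys_iff cong: if_cong)

lemma free_subspace_all:
  assumes "free.subspace S" "\<And>x. Poly_Mapping.single x 1 \<in> S"
  shows "p \<in> S"
  by (subst lin_ext_basis[symmetric], unfold lin_ext_def)
    (intro free.subspace_sum free.subspace_scale assms)

lemma subspace_linear_preimage:
  assumes "Vector_Spaces.linear s t F" "module.subspace t U"
  shows "module.subspace s {p. F p \<in> U}"
proof -
  interpret module_hom s t F using assms by (simp add: linear_iff_module_hom)
  show ?thesis using assms(2) by (rule subspace_linear_preimage)
qed

lemma linear_in_subspace:
  assumes "Vector_Spaces.linear pscale t F" "module.subspace t U"
    "\<And>x. F (Poly_Mapping.single x 1) \<in> U"
  shows "F p \<in> U"
  using free_subspace_all[OF subspace_linear_preimage[OF assms(1,2)]] assms(3) by simp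

lemma linear_eqI:
  assumes "Vector_Spaces.linear pscale t F" "Vector_Spaces.linear pscale t G"
    "\<And>x. F (Poly_Mapping.single x 1) = G (Poly_Mapping.single x 1)"
  shows "F p = G p"
proof -
  interpret t: vector_space t using assms(1) unfolding Vector_Spaces.linear_iff by blast
  show ?thesis
    using linear_in_subspace[OF linear_diff_fun[OF assms(1,2)] t.subspace_single_0] assms(3) by simp
qed

text \<open>With the target left open, unification could choose a scalar multiplication that matches
  no rule for linearity.\<close>

lemmas free_eqI = linear_eqI[where t = pscale]

lemma linear_span:
  assumes "Vector_Spaces.linear pscale t F" "module.subspace t U" "\<And>p. p \<in> G \<Longrightarrow> F p \<in> U"
    "p \<in> free.span G"
  shows "F p \<in> U"
  using assms(4) free.span_minimal[OF _ subspace_linear_preimage[OF assms(1,2)], of G] assms(3) by blast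

lemma linear_bilin_ext_right [linear_intros]:
  "Vector_Spaces.linear pscale pscale (\<lambda>q. bilin_ext h p q)"
proof -
  have "bilin_ext h p q = (\<Sum>x\<in>Poly_Mapping.keys p. pscale (Poly_Mapping.lookup p x) (lin_ext (h x) q))" for q
    by (simp add: bilin_ext_def lin_ext_def[of _ p])
  then show ?thesis
    unfolding Vector_Spaces.linear_iff
    by (simp add: vector_space_pscale sum.distrib free.scale_right_distrib free.scale_sum_right mult.commute)
qed

lemma linear_bilin_ext_left [linear_intros]:
  "Vector_Spaces.linear pscale pscale (\<lambda>p. bilin_ext h p q)"
  unfolding bilin_ext_def by (rule linear_intros)

lemmas linear_bilin_ext_left_comp [linear_intros] = linear_comp_fun[OF _ linear_bilin_ext_left]
lemmas linear_bilin_ext_right_comp [linear_intros] = linear_comp_fun[OF _ linear_bilin_ext_right]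

lemmas bilin_ext_simps [simp] = linearD[OF linear_bilin_ext_left] linearD[OF linear_bilin_ext_right]

lemma bilin_ext_single:
  "bilin_ext h (Poly_Mapping.single x c) (Poly_Mapping.single y d) = pscale (c * d) (h x y)"
  by (simp add: bilin_ext_def)

lemma lin_ext_add_fun: "lin_ext (\<lambda>x. h x + h' x) p = lin_ext h p + lin_ext h' p"
  by (rule free_eqI[where p = p], (rule linear_intros)+, simp)

lemma lin_ext_linear:
  assumes "Vector_Spaces.linear pscale pscale F"
  shows "F (lin_ext h p) = lin_ext (\<lambda>x. F (h x)) p"
  by (rule free_eqI[where p = p], rule linear_comp_fun[OF _ assms])
    ((rule linear_intros)+, simp)


section \<open>Quotients\<close>

lemma self_in_quot_class: "free.subspace U \<Longrightarrow> p \<in> quot_class U p"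
  by (simp add: quot_class_def free.subspace_0)

lemma in_quot_class_iff: "q \<in> quot_class U p \<longleftrightarrow> q - p \<in> U"
  by (simp add: quot_class_def)

lemma quot_class_eq_iff:
  assumes "free.subspace U"
  shows "quot_class U p = quot_class U q \<longleftrightarrow> p - q \<in> U"
proof
  assume "quot_class U p = quot_class U q"
  then show "p - q \<in> U"
    using self_in_quot_class[OF assms, of p] by (simp add: in_quot_class_iff)
next
  assume pq: "p - q \<in> U"
  have "r - p \<in> U \<longleftrightarrow> r - q \<in> U" for r
  proof
    show "r - q \<in> U" if "r - p \<in> U"
      using free.subspace_add[OF assms that pq] by (simp only: add_diff_eq diff_add_cancel)
    show "r - p \<in> U" if "r - q \<in> U"
      using free.subspace_diff[OF assms that pq] by (simp only: diff_diff_eq2 diff_add_cancel)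
  qed
  then show "quot_class U p = quot_class U q" unfolding quot_class_def by (rule Collect_cong)
qed

text \<open>Operations on cosets are unions over all representatives. These two lemmas collapse the
  union once independence of the representatives is known.\<close>

lemma Union_quot_class:
  assumes "free.subspace U" "\<And>q. q - p \<in> U \<Longrightarrow> F q = F p"
  shows "(\<Union>q\<in>quot_class U p. F q) = F p"
proof -
  have "(\<Union>q\<in>quot_class U p. F q) = (\<Union>q\<in>quot_class U p. F p)"
    by (rule SUP_cong) (simp_all add: assms(2) in_quot_class_iff)
  then show ?thesis using self_in_quot_class[OF assms(1), of p] by auto
qed

lemma Union_quot_class2:
  assumes "free.subspace U" "free.subspace U'"
    "\<And>q q'. q - p \<in> U \<Longrightarrow> q' - p' \<in> U' \<Longrightarrow> F q q' = F p p'"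
  shows "(\<Union>q\<in>quot_class U p. \<Union>q'\<in>quot_class U' p'. F q q') = F p p'"
proof -
  have "(\<Union>q\<in>quot_class U p. \<Union>q'\<in>quot_class U' p'. F q q')
      = (\<Union>q\<in>quot_class U p. \<Union>q'\<in>quot_class U' p'. F p p')"
    by (intro SUP_cong refl assms(3)) (simp_all add: in_quot_class_iff)
  then show ?thesis
    using self_in_quot_class[OF assms(1), of p] self_in_quot_class[OF assms(2), of p'] by auto
qed

section \<open>The symmetric algebra as a quotient of the tensor algebra\<close>

abbreviation word :: "'v list \<Rightarrow> ('v list \<Rightarrow>\<^sub>0 'k::field)"
  where "word w \<equiv> Poly_Mapping.single w 1"

abbreviation conc :: "('v list \<Rightarrow>\<^sub>0 'k::field) \<Rightarrow> ('v list \<Rightarrow>\<^sub>0 'k) \<Rightarrow> ('v list \<Rightarrow>\<^sub>0 'k)" (infixl "\<odot>" 70)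
  where "a \<odot> b \<equiv> bilin_ext word_mult a b"

lemma conc_single [simp]:
  "Poly_Mapping.single u c \<odot> Poly_Mapping.single w d = Poly_Mapping.single (u @ w) (c * d)"
  by (simp add: bilin_ext_single word_mult_def)

lemma conc_assoc: "(a \<odot> b) \<odot> c = a \<odot> (b \<odot> c)"
proof -
  have 1: "(word x \<odot> word y) \<odot> c = word x \<odot> (word y \<odot> c)" for x y
    by (rule free_eqI[where p = c], (rule linear_intros)+, simp)
  have 2: "(word x \<odot> b) \<odot> c = word x \<odot> (b \<odot> c)" for x
    by (rule free_eqI[where p = b], (rule linear_intros)+, rule 1)
  show ?thesis
    by (rule free_eqI[where p = a], (rule linear_intros)+, rule 2)
qed

lemma conc_Nil [simp]: "word [] \<odot> a = a" "a \<odot> word [] = a"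
  by (rule free_eqI[where p = a], (rule linear_intros)+, simp)+

lemma word_Cons: "word (x # xs) = word [x] \<odot> word xs"
  by simp

text \<open>The three families of relations differ only in a factor of degree one or two, placed
  between arbitrary words. A map that behaves well under concatenation can therefore be checked
  on these factors alone.\<close>

definition letter_rel :: "('k::field \<Rightarrow> 'v::ab_group_add \<Rightarrow> 'v) \<Rightarrow> ('v list \<Rightarrow>\<^sub>0 'k) set"
  where "letter_rel s =
    {word [u + v] - word [u] - word [v] | u v. True} \<union>
    {word [s c v] - Poly_Mapping.single [v] c | c v. True} \<union>
    {word [u, v] - word [v, u] | u v. True}"

lemma letter_relE:
  assumes "r \<in> letter_rel s"
  obtains (add) u v where "r = word [u + v] - word [u] - word [v]"
  | (scale) c v where "r = word [s c v] - Poly_Mapping.single [v] c"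
  | (swap) u v where "r = word [u, v] - word [v, u]"
  using assms by (auto simp: letter_rel_def)

lemma sym_rel_eq_ideal:
  "sym_rel s = free.span {word p \<odot> r \<odot> word q | p q r. r \<in> letter_rel s}"
proof -
  have "{word p \<odot> r \<odot> word q | p q r. r \<in> letter_rel s} =
    {word p \<odot> (word [u + v] - word [u] - word [v]) \<odot> word q | p q u v. True} \<union>
    {word p \<odot> (word [s c v] - Poly_Mapping.single [v] c) \<odot> word q | p q c v. True} \<union>
    {word p \<odot> (word [u, v] - word [v, u]) \<odot> word q | p q u v. True}"
    unfolding letter_rel_def by blast
  then show ?thesis by (simp add: sym_rel_def)
qed

lemma subspace_sym_rel [simp]: "free.subspace (sym_rel s)"
  by (simp add: sym_rel_eq_ideal)

lemmas sym_rel_add = free.subspace_add[OF subspace_sym_rel]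
lemmas sym_rel_diff = free.subspace_diff[OF subspace_sym_rel]
lemmas sym_rel_scale = free.subspace_scale[OF subspace_sym_rel]

lemma linear_sym_rel:
  assumes "Vector_Spaces.linear pscale t F" "module.subspace t U" "a \<in> sym_rel s"
    "\<And>p q r. r \<in> letter_rel s \<Longrightarrow> F (word p \<odot> r \<odot> word q) \<in> U"
  shows "F a \<in> U"
  by (rule linear_span[OF assms(1,2) _ assms(3)[unfolded sym_rel_eq_ideal]]) (use assms(4) in auto)

lemma letter_rel_sym_rel: "r \<in> letter_rel s \<Longrightarrow> r \<in> sym_rel s"
  unfolding sym_rel_eq_ideal
  by (rule free.span_base) (metis (mono_tags, lifting) conc_Nil mem_Collect_eq)

lemma letters_sym_rel:
  "word [u + v] - word [u] - word [v] \<in> sym_rel s"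
  "word [s c v] - pscale c (word [v]) \<in> sym_rel s"
  "word [u, v] - word [v, u] \<in> sym_rel s"
  by (rule letter_rel_sym_rel, force simp: letter_rel_def)+

lemma sym_rel_conc_left: 
  assumes "a \<in> sym_rel s" shows "b \<odot> a \<in> sym_rel s"
proof (rule linear_sym_rel[OF _ subspace_sym_rel assms])
  show "Vector_Spaces.linear pscale pscale ((\<odot>) b)" by (rule linear_intros)
  fix p q r assume r: "r \<in> letter_rel s"
  have word: "word w \<odot> (word p \<odot> r \<odot> word q) \<in> sym_rel s" for w
  proof -
    have "word w \<odot> (word p \<odot> r \<odot> word q) = word (w @ p) \<odot> r \<odot> word q"
      by (simp add: conc_assoc[symmetric])
    then show ?thesis using r unfolding sym_rel_eq_ideal by (auto intro!: free.span_base)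
  qed
  show "b \<odot> (word p \<odot> r \<odot> word q) \<in> sym_rel s"
    by (rule linear_in_subspace[where p = b, OF linear_bilin_ext_left subspace_sym_rel word])
qed

lemma sym_rel_conc_right: 
  assumes "a \<in> sym_rel s" shows "a \<odot> b \<in> sym_rel s"
proof (rule linear_sym_rel[OF _ subspace_sym_rel assms])
  show "Vector_Spaces.linear pscale pscale (\<lambda>a. a \<odot> b)" by (rule linear_intros)
  fix p q r assume r: "r \<in> letter_rel s"
  have word: "word p \<odot> r \<odot> word q \<odot> word w \<in> sym_rel s" for w
  proof -
    have "word p \<odot> r \<odot> word q \<odot> word w = word p \<odot> r \<odot> word (q @ w)"
      by (simp add: conc_assoc)
    then show ?thesis using r unfolding sym_rel_eq_ideal by (auto intro!: free.span_base)
  qed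
  show "word p \<odot> r \<odot> word q \<odot> b \<in> sym_rel s"
    by (rule linear_in_subspace[where p = b, OF linear_bilin_ext_right subspace_sym_rel word])
qed

text \<open>Adjacent letters commute by definition; moving one letter through a word, and then one word
  through another, takes two inductions.\<close>

lemma conc_commute: "a \<odot> b - b \<odot> a \<in> sym_rel s"
proof -
  have letter: "word [x] \<odot> word w - word w \<odot> word [x] \<in> sym_rel s" for x w
  proof (induction w)
    case Nil
    show ?case by (simp add: free.subspace_0)
  next
    case (Cons y w)
    have "word [x] \<odot> word (y # w) - word (y # w) \<odot> word [x] =
        (word [x, y] - word [y, x]) \<odot> word w + word [y] \<odot> (word [x] \<odot> word w - word w \<odot> word [x])"
      by simp
    then show ?case
      using sym_rel_add[OF sym_rel_conc_right[OF letters_sym_rel(3)] sym_rel_conc_left[OF Cons.IH]] by metis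
  qed
  have words: "word u \<odot> word w - word w \<odot> word u \<in> sym_rel s" for u w
  proof (induction u)
    case Nil
    show ?case by (simp add: free.subspace_0)
  next
    case (Cons x u)
    have "word (x # u) \<odot> word w - word w \<odot> word (x # u) =
        word [x] \<odot> (word u \<odot> word w - word w \<odot> word u) + (word [x] \<odot> word w - word w \<odot> word [x]) \<odot> word u"
      by simp
    then show ?case
      using sym_rel_add[OF sym_rel_conc_left[OF Cons.IH] sym_rel_conc_right[OF letter]] by metis
  qed
  have word: "word u \<odot> b - b \<odot> word u \<in> sym_rel s" for u
    by (rule linear_in_subspace[where p = b and F = "\<lambda>b. word u \<odot> b - b \<odot> word u", OF _ subspace_sym_rel words])
      (rule linear_intros)+
  show ?thesis
    by (rule linear_in_subspace[where p = a and F = "\<lambda>a. a \<odot> b - b \<odot> a", OF _ subspace_sym_rel word])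
      (rule linear_intros)+
qed

text \<open>The relations are homogeneous, so \<open>S(V)\<close> is graded by the length of words. Instead of
  decomposing elements into finite sums of components, all uses of the grading go through the operator that
  multiplies the component of degree \<open>n\<close> by \<open>c n\<close>; projections are the case of coefficients
  \<open>0\<close> and \<open>1\<close>.\<close>

definition grade_scale :: "(nat \<Rightarrow> 'k::field) \<Rightarrow> ('v list \<Rightarrow>\<^sub>0 'k) \<Rightarrow> ('v list \<Rightarrow>\<^sub>0 'k)"
  where "grade_scale c = lin_ext (\<lambda>w. Poly_Mapping.single w (c (length w)))"

lemma linear_grade_scale [linear_intros]: "Vector_Spaces.linear pscale pscale (grade_scale c)"
  unfolding grade_scale_def by (rule linear_intros)

lemma grade_scale_single [simp]:
  "grade_scale c (Poly_Mapping.single w d) = Poly_Mapping.single w (d * c (length w))"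
  by (simp add: grade_scale_def)

lemmas grade_scale_simps [simp] = linearD[OF linear_grade_scale]

lemma grade_scale_sym_rel: 
  assumes "a \<in> sym_rel s" shows "grade_scale c a \<in> sym_rel s"
proof (rule linear_sym_rel[OF linear_grade_scale subspace_sym_rel assms])
  fix p q r assume r: "r \<in> letter_rel s"
  then obtain n where "grade_scale c (word p \<odot> r \<odot> word q) = pscale (c n) (word p \<odot> r \<odot> word q)"
  proof (cases rule: letter_relE)
    case (swap u v)
    show ?thesis
      by (rule that[of "length p + length q + 2"])
        (simp add: swap free.scale_right_diff_distrib)
  qed (rule that[of "length p + length q + 1"],
        simp add: free.scale_right_diff_distrib mult.commute)+
  moreover have "word p \<odot> r \<odot> word q \<in> sym_rel s"
    by (intro sym_rel_conc_left sym_rel_conc_right letter_rel_sym_rel r)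
  ultimately show "grade_scale c (word p \<odot> r \<odot> word q) \<in> sym_rel s"
    by (simp add: sym_rel_scale)
qed

lemma grade_scale_grade_scale: "grade_scale c (grade_scale d a) = grade_scale (\<lambda>n. c n * d n) a"
  by (rule free_eqI[where p = a], rule linear_comp_fun; (rule linear_grade_scale)?) (simp add: mult.commute)

lemma grade_scale_diff: "grade_scale c a - grade_scale d a = grade_scale (\<lambda>n. c n - d n) a"
  by (rule free_eqI[where p = a], (rule linear_intros)+, simp add: single_diff)

lemma grade_scale_const: "grade_scale (\<lambda>_. c) a = pscale c a"
  by (rule free_eqI[where p = a], (rule linear_intros)+, simp)

text \<open>The degree one part of an element, evaluated in \<open>V\<close>. It vanishes on all relations, hence
  separates the classes of distinct letters: \<open>V\<close> embeds into \<open>S(V)\<close>.\<close>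

definition letter_part :: "('k::field \<Rightarrow> 'v::ab_group_add \<Rightarrow> 'v) \<Rightarrow> ('v list \<Rightarrow>\<^sub>0 'k) \<Rightarrow> 'v"
  where "letter_part s = free_lift s (\<lambda>w. case w of [v] \<Rightarrow> v | _ \<Rightarrow> 0)"

lemma linear_letter_part [linear_intros]:
  "vector_space s \<Longrightarrow> Vector_Spaces.linear pscale s (letter_part s)"
  unfolding letter_part_def by (rule linear_intros)

lemmas letter_part_simps = linearD[OF linear_letter_part]

lemma letter_part_single:
  "vector_space s \<Longrightarrow>
    letter_part s (Poly_Mapping.single w c) = s c (case w of [v] \<Rightarrow> v | _ \<Rightarrow> 0)"
  unfolding letter_part_def by simp

lemma letter_part_sym_rel:
  assumes "vector_space s" "a \<in> sym_rel s" shows "letter_part s a = 0"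
proof -
  interpret vector_space s by fact
  have "letter_part s a \<in> {0}"
  proof (rule linear_sym_rel[OF linear_letter_part[OF assms(1)] subspace_single_0 assms(2)])
    fix p q r assume r: "r \<in> letter_rel s"
    note simps = letter_part_single[OF assms(1)] letter_part_simps[OF assms(1)]
    have "(case p @ x # q of [v] \<Rightarrow> v | _ \<Rightarrow> 0) = (if p = [] \<and> q = [] then x else 0)"
      "(case p @ x # y # q of [v] \<Rightarrow> v | _ \<Rightarrow> 0) = 0" for x y :: 'b
      by (auto split: list.split simp: append_eq_Cons_conv)
    with r show "letter_part s (word p \<odot> r \<odot> word q) \<in> {0}"
      by (cases rule: letter_relE) (auto simp: simps)
  qed
  then show ?thesis by simp
qed

text \<open>A linear combination of letters is, modulo the relations, one single letter. As
  \<open>v \<mapsto> word [v]\<close> is linear only modulo the relations, the proof shows that the elements with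
  the claimed property form a subspace.\<close>

lemma degree_one_part:
  assumes "vector_space s"
  shows "grade_scale (\<lambda>n. if n = 1 then 1 else 0) a - word [letter_part s a] \<in> sym_rel s"
    (is "?P a - _ \<in> _")
proof -
  interpret s: vector_space s by fact
  note simps = letter_part_single[OF assms(1)] letter_part_simps[OF assms(1)]
  have zero: "word [0] \<in> sym_rel s"
    using letters_sym_rel(2)[of s 0 0] by simp
  have "a \<in> {a. ?P a - word [letter_part s a] \<in> sym_rel s}"
  proof (rule free_subspace_all, rule free.subspaceI)
    show "0 \<in> {a. ?P a - word [letter_part s a] \<in> sym_rel s}"
      using free.subspace_neg[OF subspace_sym_rel zero] by (simp add: simps)
  next
    fix a b assume "a \<in> {a. ?P a - word [letter_part s a] \<in> sym_rel s}"
      "b \<in> {a. ?P a - word [letter_part s a] \<in> sym_rel s}"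
    then have ab: "?P a - word [letter_part s a] \<in> sym_rel s" "?P b - word [letter_part s b] \<in> sym_rel s"
      by auto
    let ?u = "letter_part s a" and ?v = "letter_part s b"
    have "?P (a + b) - word [?u + ?v]
      = (?P a - word [?u]) + (?P b - word [?v]) - (word [?u + ?v] - word [?u] - word [?v])"
      by simp
    also have "\<dots> \<in> sym_rel s" by (intro sym_rel_diff sym_rel_add ab letters_sym_rel)
    finally show "a + b \<in> {a. ?P a - word [letter_part s a] \<in> sym_rel s}"
      by (simp add: simps)
  next
    fix c a assume "a \<in> {a. ?P a - word [letter_part s a] \<in> sym_rel s}"
    then have a: "?P a - word [letter_part s a] \<in> sym_rel s" by auto
    let ?u = "letter_part s a"
    have "?P (pscale c a) - word [s c ?u]
      = pscale c (?P a - word [?u]) - (word [s c ?u] - pscale c (word [?u]))"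
      by (simp add: free.scale_right_diff_distrib)
    also have "\<dots> \<in> sym_rel s" by (intro sym_rel_diff sym_rel_scale a letters_sym_rel)
    finally show "pscale c a \<in> {a. ?P a - word [letter_part s a] \<in> sym_rel s}"
      by (simp add: simps)
  next
    fix w :: "'b list"
    have "\<not> length w = 1 \<Longrightarrow> (case w of [v] \<Rightarrow> v | _ \<Rightarrow> 0) = 0"
      by (auto split: list.split)
    then show "word w \<in> {a. ?P a - word [letter_part s a] \<in> sym_rel s}"
      using free.subspace_neg[OF subspace_sym_rel zero]
      by (cases "length w = 1") (auto simp: simps length_Suc_conv free.subspace_0)
  qed
  then show ?thesis by simp
qed

lemma sym_class_eq_iff: "sym_class s a = sym_class s b \<longleftrightarrow> a - b \<in> sym_rel s"
  by (rule quot_class_eq_iff) simp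

lemma sym_class_letter:
  "sym_class s (word [u + v]) = sym_class s (word [u] + word [v])"
  "sym_class s (word [s c v]) = sym_class s (pscale c (word [v]))"
  using letters_sym_rel(1,2) by (simp_all add: sym_class_eq_iff diff_diff_eq)

lemma letter_part_class:
  assumes "vector_space s" "sym_class s a = sym_class s b"
  shows "letter_part s a = letter_part s b"
  using letter_part_sym_rel[OF assms(1), of "a - b"] assms
  by (simp add: sym_class_eq_iff letter_part_simps)

lemma sym_class_letter_inj:
  assumes "vector_space s" "sym_class s (word [u]) = sym_class s (word [v])"
  shows "u = v"
proof -
  interpret vector_space s by fact
  show ?thesis
    using letter_part_class[OF assms] by (simp add: letter_part_single[OF assms(1)])
qed

section \<open>The preLie product on the symmetric algebra\<close>

text \<open>The sum over all subsets \<open>I\<close> of positions, with \<open>|I|!\<close> replaced by \<open>(n + |I|)!\<close>.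
  The factorial depends on the size of the whole subset, so splitting off the first position (which either
  lies in \<open>I\<close> or does not) yields a recursion only when the shift \<open>n\<close> is allowed to grow.\<close>

primrec contraction ::
  "('v \<Rightarrow> 'k::field_char_0) \<Rightarrow> 'k \<Rightarrow> 'v list \<Rightarrow> nat \<Rightarrow> ('v list \<Rightarrow>\<^sub>0 'k)"
  where
    "contraction f lam [] n = Poly_Mapping.single [] (fact n)"
  | "contraction f lam (y # ys) n =
      word [y] \<odot> contraction f lam ys n + pscale (lam * f y) (contraction f lam ys (Suc n))"

lemma contraction_eq_sum:
  "contraction f lam ys n =
    (\<Sum>I\<in>Pow {..<length ys}. Poly_Mapping.single (nths ys ({..<length ys} - I))
      (fact (n + card I) * lam ^ card I * (\<Prod>i\<in>I. f (ys ! i))))"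
proof (induction ys arbitrary: n)
  case Nil
  show ?case by simp
next
  case (Cons y ys)
  let ?N = "{..<length ys}"
  let ?g = "\<lambda>n ys I. Poly_Mapping.single (nths ys ({..<length ys} - I))
      (fact (n + card I) * lam ^ card I * (\<Prod>i\<in>I. f (ys ! i)))"
  have Pow: "Pow {..<length (y # ys)} = (`) Suc ` Pow ?N \<union> insert 0 ` (`) Suc ` Pow ?N"
    by (simp add: lessThan_Suc_eq_insert_0 Pow_insert image_Pow_surj[OF refl, of Suc])
  have inj: "inj_on ((`) Suc) (Pow ?N)" "inj_on (insert 0) ((`) Suc ` Pow ?N)"
    by (auto intro!: inj_onI simp: inj_image_eq_iff)
  have out: "?g n (y # ys) (Suc ` I) = word [y] \<odot> ?g n ys I" if "I \<in> Pow ?N" for I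
  proof -
    have "{j. Suc j \<in> {..<length (y # ys)} - Suc ` I} = ?N - I" by auto
    moreover have "0 \<in> {..<length (y # ys)} - Suc ` I" by auto
    ultimately show ?thesis
      by (simp add: nths_Cons card_image prod.reindex)
  qed
  have into: "?g n (y # ys) (insert 0 (Suc ` I)) = pscale (lam * f y) (?g (Suc n) ys I)"
    if "I \<in> Pow ?N" for I
  proof -
    have "{j. Suc j \<in> {..<length (y # ys)} - insert 0 (Suc ` I)} = ?N - I" by auto
    moreover have "finite I" using that finite_subset by auto
    ultimately show ?thesis
      by (simp add: nths_Cons card_image prod.reindex algebra_simps)
  qed
  have "(\<Sum>I\<in>Pow {..<length (y # ys)}. ?g n (y # ys) I) =
      (\<Sum>I\<in>(`) Suc ` Pow ?N. ?g n (y # ys) I) + (\<Sum>I\<in>insert 0 ` (`) Suc ` Pow ?N. ?g n (y # ys) I)"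
    unfolding Pow by (rule sum.union_disjoint) auto
  also have "\<dots> = (\<Sum>I\<in>Pow ?N. ?g n (y # ys) (Suc ` I)) + (\<Sum>I\<in>Pow ?N. ?g n (y # ys) (insert 0 (Suc ` I)))"
    by (simp only: sum.reindex[OF inj(1)] sum.reindex[OF inj(2)] o_def)
  also have "\<dots> = (\<Sum>I\<in>Pow ?N. word [y] \<odot> ?g n ys I) + (\<Sum>I\<in>Pow ?N. pscale (lam * f y) (?g (Suc n) ys I))"
    by (simp only: out into cong: sum.cong)
  also have "\<dots> = contraction f lam (y # ys) n"
    by (simp only: contraction.simps Cons.IH bilin_ext_simps free.scale_sum_right)
  finally show ?case ..
qed

text \<open>Only the full set \<open>I = [k]\<close> contributes in degree zero. Removing the degree zero part
  therefore restricts the sum to proper subsets, and the homogeneous relations are preserved.\<close>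

definition bullet_kernel :: "('v \<Rightarrow> 'k::field_char_0) \<Rightarrow> 'k \<Rightarrow> 'v list \<Rightarrow> ('v list \<Rightarrow>\<^sub>0 'k)"
  where "bullet_kernel f lam ys = grade_scale (\<lambda>n. if n = 0 then 0 else 1) (contraction f lam ys 0)"

lemma letter_bullet_eq: "letter_bullet f lam x ys = pscale (f x) (bullet_kernel f lam ys)"
proof -
  let ?N = "{..<length ys}"
  let ?c = "\<lambda>I. fact (card I) * lam ^ card I * (\<Prod>i\<in>I. f (ys ! i))"
  let ?g = "\<lambda>I. Poly_Mapping.single (nths ys (?N - I)) (?c I)"
  have grade: "grade_scale (\<lambda>n. if n = 0 then 0 else 1) (?g I) = (if I = ?N then 0 else ?g I)"
    if "I \<in> Pow ?N" for I
  proof -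
    have "length (nths ys (?N - I)) = card (?N - I)"
      by (simp add: length_nths) (rule arg_cong[of _ _ card], auto)
    moreover have "card (?N - I) = 0 \<longleftrightarrow> I = ?N"
      using that by auto
    ultimately show ?thesis by simp
  qed
  have "bullet_kernel f lam ys = (\<Sum>I\<in>Pow ?N. if I = ?N then 0 else ?g I)"
    unfolding bullet_kernel_def contraction_eq_sum grade_scale_simps
    by (rule sum.cong[OF refl]) (use grade in simp)
  also have "\<dots> = (\<Sum>I | I \<subset> ?N. ?g I)"
    by (rule sum.mono_neutral_cong_right) auto
  finally show ?thesis
    by (simp add: letter_bullet_def free.scale_sum_right algebra_simps)
qed

lemma word_bullet_Cons:
  "word_bullet f lam (x # xs) ys = letter_bullet f lam x ys \<odot> word xs + word [x] \<odot> word_bullet f lam xs ys"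
proof -
  have right: "lin_ext (\<lambda>w. word (w @ xs)) a = a \<odot> word xs" for a :: "'a list \<Rightarrow>\<^sub>0 'b"
    by (rule free_eqI[where p = a], (rule linear_intros)+, simp)
  show ?thesis
    by (simp add: word_bullet_def sum.lessThan_Suc_shift right lin_ext_linear[OF linear_bilin_ext_right]
      del: sum.lessThan_Suc)
qed

lemma word_bullet_Nil [simp]: "word_bullet f lam [] ys = 0"
  by (simp add: word_bullet_def)

lemma bullet_words [simp]: "bilin_ext (word_bullet f lam) (word xs) (word ys) = word_bullet f lam xs ys"
  by (simp add: bilin_ext_single)

text \<open>Because of this Leibniz rule, compatibility of \<open>a \<bullet> b\<close> with the relations in \<open>a\<close> needs
  checking only on the relations among letters, where it reduces to the values \<open>x \<bullet> b\<close> below.\<close>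

lemma bullet_derivation:
  "bilin_ext (word_bullet f lam) (a \<odot> a') b =
    bilin_ext (word_bullet f lam) a b \<odot> a' + a \<odot> bilin_ext (word_bullet f lam) a' b"
    (is "?D (a \<odot> a') b = ?D a b \<odot> a' + a \<odot> ?D a' b")
proof -
  have 1: "?D (word xs \<odot> word xs') (word ys) =
      ?D (word xs) (word ys) \<odot> word xs' + word xs \<odot> ?D (word xs') (word ys)" for xs xs' ys
  proof (induction xs)
    case (Cons x xs)
    have "word (x # xs) \<odot> c = word [x] \<odot> (word xs \<odot> c)" for c :: "'a list \<Rightarrow>\<^sub>0 'b"
      by (simp add: conc_assoc[symmetric])
    with Cons show ?case by (simp add: word_bullet_Cons conc_assoc)
  qed simp
  have 2: "?D (word xs \<odot> word xs') b = ?D (word xs) b \<odot> word xs' + word xs \<odot> ?D (word xs') b" for xs xs'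
    by (rule free_eqI[where p = b], (rule linear_intros)+, rule 1)
  have 3: "?D (word xs \<odot> a') b = ?D (word xs) b \<odot> a' + word xs \<odot> ?D a' b" for xs
    by (rule free_eqI[where p = a'], (rule linear_intros)+, rule 2)
  show ?thesis
    by (rule free_eqI[where p = a], (rule linear_intros)+, rule 3)
qed

lemma bullet_letter:
  "bilin_ext (word_bullet f lam) (word [x]) b = pscale (f x) (lin_ext (bullet_kernel f lam) b)"
  by (rule free_eqI[where p = b], (rule linear_intros)+) (simp add: word_bullet_Cons letter_bullet_eq)

text \<open>For a relation \<open>r\<close> among letters, each of the three cases gives
  \<open>C\<^sub>n(r q) = r C\<^sub>n(q)\<close>, where \<open>C\<^sub>n\<close> denotes the contraction with shift \<open>n\<close>:
  the terms that involve \<open>f\<close> cancel, by linearity of \<open>f\<close> or by symmetry in the two letters. The recursion then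
  carries the claim past a prefix \<open>p\<close>, for all \<open>n\<close> at once.\<close>

lemma contraction_sym_rel:
  fixes f :: "'v::ab_group_add \<Rightarrow> 'k::field_char_0"
  assumes f: "Vector_Spaces.linear s (*) f" and a: "a \<in> sym_rel s"
  shows "lin_ext (\<lambda>ys. contraction f lam ys n) a \<in> sym_rel s"
proof (rule linear_sym_rel[OF linear_lin_ext subspace_sym_rel a])
  let ?C = "\<lambda>n. lin_ext (\<lambda>ys. contraction f lam ys n)"
  have f_add: "f (u + v) = f u + f v" and f_scale: "f (s c v) = c * f v" for u v c
    using f by (simp_all add: linearD)
  have step: "?C n (word [y] \<odot> a) = word [y] \<odot> ?C n a + pscale (lam * f y) (?C (Suc n) a)" for n y a
    by (rule free_eqI[where p = a], (rule linear_intros)+, simp)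
  fix p q r assume r: "r \<in> letter_rel s"
  have "?C n (r \<odot> word q) \<in> sym_rel s" for n
    using r
  proof (cases rule: letter_relE)
    case (add u v)
    have "?C n (r \<odot> word q) = r \<odot> contraction f lam q n"
      by (simp add: add f_add free.scale_left_distrib distrib_left)
    then show ?thesis by (simp add: sym_rel_conc_right letter_rel_sym_rel[OF r])
  next
    case (scale c v)
    have "Poly_Mapping.single [v] c = pscale c (word [v])" by simp
    then have "?C n (r \<odot> word q) = r \<odot> contraction f lam q n"
      unfolding scale by (simp add: f_scale free.scale_right_distrib mult.left_commute del: pscale_single) 
    then show ?thesis by (simp add: sym_rel_conc_right letter_rel_sym_rel[OF r])
  next
    case (swap u v)
    have "word [x, y] \<odot> c = word [x] \<odot> (word [y] \<odot> c)" for x y and c :: "'v list \<Rightarrow>\<^sub>0 'k"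
      by (simp add: conc_assoc[symmetric])
    then have "?C n (r \<odot> word q) = r \<odot> contraction f lam q n"
      unfolding swap by (simp add: free.scale_right_distrib algebra_simps)
    then show ?thesis by (simp add: sym_rel_conc_right letter_rel_sym_rel[OF r])
  qed
  then have "?C n (word p \<odot> (r \<odot> word q)) \<in> sym_rel s" for n
  proof (induction p arbitrary: n)
    case (Cons y p)
    have "word (y # p) \<odot> (r \<odot> word q) = word [y] \<odot> (word p \<odot> (r \<odot> word q))"
      by (simp add: conc_assoc[symmetric])
    then show ?case
      by (simp only: step) (intro sym_rel_add sym_rel_conc_left sym_rel_scale Cons)
  qed simp
  then show "?C n (word p \<odot> r \<odot> word q) \<in> sym_rel s" by (simp add: conc_assoc)
qed

lemma bullet_sym_rel_right:
  fixes f :: "'v::ab_group_add \<Rightarrow> 'k::field_char_0"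
  assumes f: "Vector_Spaces.linear s (*) f" and b: "b \<in> sym_rel s"
  shows "bilin_ext (word_bullet f lam) a b \<in> sym_rel s"
proof -
  let ?D = "bilin_ext (word_bullet f lam)"
  have "lin_ext (bullet_kernel f lam) b =
      grade_scale (\<lambda>n. if n = 0 then 0 else 1) (lin_ext (\<lambda>ys. contraction f lam ys 0) b)"
    by (simp add: bullet_kernel_def[abs_def] lin_ext_linear[OF linear_grade_scale])
  then have kernel: "lin_ext (bullet_kernel f lam) b \<in> sym_rel s"
    by (simp add: grade_scale_sym_rel contraction_sym_rel f b)
  have words: "?D (word xs) b \<in> sym_rel s" for xs
  proof (induction xs)
    case Nil
    have "?D (word []) b = 0"
      by (rule free_eqI[where p = b], (rule linear_intros)+, simp)
    then show ?case by (simp add: free.subspace_0)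
  next
    case (Cons x xs)
    show ?case
      by (subst word_Cons, unfold bullet_derivation bullet_letter)
        (intro sym_rel_add sym_rel_conc_left sym_rel_conc_right sym_rel_scale kernel Cons)
  qed
  show ?thesis
    by (rule linear_in_subspace[where p = a, OF linear_bilin_ext_left subspace_sym_rel words])
qed

lemma bullet_sym_rel_left:
  fixes f :: "'v::ab_group_add \<Rightarrow> 'k::field_char_0"
  assumes f: "Vector_Spaces.linear s (*) f" and a: "a \<in> sym_rel s"
  shows "bilin_ext (word_bullet f lam) a b \<in> sym_rel s"
proof (rule linear_sym_rel[OF linear_bilin_ext_left subspace_sym_rel a])
  let ?D = "bilin_ext (word_bullet f lam)"
  have f_add: "f (u + v) = f u + f v" and f_scale: "f (s c v) = c * f v" for u v c
    using f by (simp_all add: linearD)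
  fix p q r assume r: "r \<in> letter_rel s"
  have "?D r b \<in> sym_rel s"
    using r
  proof (cases rule: letter_relE)
    case (add u v)
    then have "?D r b = 0"
      by (simp add: bullet_letter f_add free.scale_left_distrib)
    then show ?thesis by (simp add: free.subspace_0)
  next
    case (scale c v)
    have "Poly_Mapping.single [v] c = pscale c (word [v])" by simp
    then have "?D r b = 0"
      unfolding scale by (simp add: bullet_letter f_scale del: pscale_single)
    then show ?thesis by (simp add: free.subspace_0)
  next
    case (swap u v)
    let ?k = "lin_ext (bullet_kernel f lam) b"
    have words: "word [u, v] = word [u] \<odot> word [v]" "word [v, u] = word [v] \<odot> word [u]" by simp_all
    have "?D r b = pscale (f u) (?k \<odot> word [v] - word [v] \<odot> ?k) + pscale (f v) (word [u] \<odot> ?k - ?k \<odot> word [u])"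
      unfolding swap bilin_ext_simps words bullet_derivation bullet_letter
      by (simp add: free.scale_right_diff_distrib)
    also have "\<dots> \<in> sym_rel s"
      by (intro sym_rel_add sym_rel_scale conc_commute)
    finally show ?thesis .
  qed
  then show "?D (word p \<odot> r \<odot> word q) b \<in> sym_rel s"
    unfolding bullet_derivation
    by (intro sym_rel_add sym_rel_conc_right sym_rel_conc_left letter_rel_sym_rel[OF r])
      (auto intro!: sym_rel_add sym_rel_conc_right sym_rel_conc_left letter_rel_sym_rel[OF r]
        simp: bilin_ext_simps)
qed

section \<open>Operations on classes\<close>

lemma sym_class_cong: "a - b \<in> sym_rel s \<Longrightarrow> sym_class s a = sym_class s b"
  by (simp add: sym_class_eq_iff)

lemma carrier_sym_vsp: "carrier (sym_vsp s) = range (sym_class s)"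
  by (simp add: sym_vsp_def)

lemma add_sym_vsp: "add (sym_vsp s) (sym_class s a) (sym_class s b) = sym_class s (a + b)"
proof -
  have "(\<Union>a'\<in>sym_class s a. \<Union>b'\<in>sym_class s b. sym_class s (a' + b')) = sym_class s (a + b)"
  proof (rule Union_quot_class2[OF subspace_sym_rel subspace_sym_rel], rule sym_class_cong)
    fix a' b' assume "a' - a \<in> sym_rel s" "b' - b \<in> sym_rel s"
    from sym_rel_add[OF this] show "a' + b' - (a + b) \<in> sym_rel s"
      by (simp add: algebra_simps)
  qed
  then show ?thesis by (simp add: sym_vsp_def)
qed

lemma smult_sym_vsp: "smult (sym_vsp s) c (sym_class s a) = sym_class s (pscale c a)"
proof -
  have "(\<Union>a'\<in>sym_class s a. sym_class s (pscale c a')) = sym_class s (pscale c a)"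
    by (rule Union_quot_class[OF subspace_sym_rel], rule sym_class_cong)
      (simp add: free.scale_right_diff_distrib[symmetric] sym_rel_scale)
  then show ?thesis by (simp add: sym_vsp_def)
qed

lemma S_bialgebra_vsp [simp]:
  "carrier (S_bialgebra s f lam) = range (sym_class s)"
  "add (S_bialgebra s f lam) = add (sym_vsp s)"
  "smult (S_bialgebra s f lam) = smult (sym_vsp s)"
  "one (S_bialgebra s f lam) = sym_class s (word [])"
  "tensor_rel (S_bialgebra s f lam) = tensor_rel (sym_vsp s)"
  by (simp_all add: S_bialgebra_def tensor_rel_def sym_vsp_def)

lemma bilinear_on_classes:
  assumes "\<And>a b. a \<in> sym_rel s \<Longrightarrow> bilin_ext h a b \<in> sym_rel s"
    and "\<And>a b. b \<in> sym_rel s \<Longrightarrow> bilin_ext h a b \<in> sym_rel s"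
  shows "(\<Union>a'\<in>sym_class s a. \<Union>b'\<in>sym_class s b. sym_class s (bilin_ext h a' b')) = sym_class s (bilin_ext h a b)"
proof (rule Union_quot_class2[OF subspace_sym_rel subspace_sym_rel], rule sym_class_cong)
  fix a' b' assume "a' - a \<in> sym_rel s" "b' - b \<in> sym_rel s"
  then have "bilin_ext h (a' - a) b' + bilin_ext h a (b' - b) \<in> sym_rel s"
    by (intro sym_rel_add assms)
  then show "bilin_ext h a' b' - bilin_ext h a b \<in> sym_rel s" by simp
qed

lemma mult_S_bialgebra:
  "mult (S_bialgebra s f lam) (sym_class s a) (sym_class s b) = sym_class s (a \<odot> b)"
  by (simp add: S_bialgebra_def bilinear_on_classes sym_rel_conc_left sym_rel_conc_right)

lemma bullet_S_bialgebra:
  fixes f :: "'v::ab_group_add \<Rightarrow> 'k::field_char_0"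
  assumes "Vector_Spaces.linear s (*) f"
  shows "bullet (S_bialgebra s f lam) (sym_class s a) (sym_class s b) =
    sym_class s (bilin_ext (word_bullet f lam) a b)"
  by (simp add: S_bialgebra_def bilinear_on_classes bullet_sym_rel_left[OF assms] bullet_sym_rel_right[OF assms])

text \<open>A representative, in the free vector space on pairs of classes, of the coproduct of the class of
  \<open>a\<close>.\<close>

definition comult_lift ::
  "('k::field \<Rightarrow> 'v::ab_group_add \<Rightarrow> 'v) \<Rightarrow> ('v list \<Rightarrow>\<^sub>0 'k) \<Rightarrow>
    ((('v list \<Rightarrow>\<^sub>0 'k) set \<times> ('v list \<Rightarrow>\<^sub>0 'k) set) \<Rightarrow>\<^sub>0 'k)"
  where "comult_lift s a =
    lin_ext (\<lambda>(u, w). Poly_Mapping.single (sym_class s (word u), sym_class s (word w)) 1)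
      (lin_ext word_comult a)"

lemma linear_comult_lift: "Vector_Spaces.linear pscale pscale (comult_lift s)"
  unfolding comult_lift_def by (rule linear_intros)+

lemma comult_S_bialgebra:
  "comult (S_bialgebra s f lam) X = (\<Union>a\<in>X. quot_class (tensor_rel (sym_vsp s)) (comult_lift s a))"
  by (simp add: S_bialgebra_def comult_lift_def)

lemma subspace_tensor_rel [simp]: "free.subspace (tensor_rel A)"
  by (simp add: tensor_rel_def)

lemma linear_tensor_rel:
  fixes A :: "('a, 'k::field, 'z) vsp_scheme"
  assumes "Vector_Spaces.linear pscale t F" "module.subspace t U" "p \<in> tensor_rel A"
    "\<And>a a' b. \<lbrakk>a \<in> carrier A; a' \<in> carrier A; b \<in> carrier A\<rbrakk> \<Longrightarrow>
      F (Poly_Mapping.single (add A a a', b) 1 - Poly_Mapping.single (a, b) 1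
        - Poly_Mapping.single (a', b) 1) \<in> U"
    "\<And>a b b'. \<lbrakk>a \<in> carrier A; b \<in> carrier A; b' \<in> carrier A\<rbrakk> \<Longrightarrow>
      F (Poly_Mapping.single (a, add A b b') 1 - Poly_Mapping.single (a, b) 1
        - Poly_Mapping.single (a, b') 1) \<in> U"
    "\<And>c a b. \<lbrakk>a \<in> carrier A; b \<in> carrier A\<rbrakk> \<Longrightarrow>
      F (Poly_Mapping.single (smult A c a, b) 1 - Poly_Mapping.single (a, b) c) \<in> U"
    "\<And>c a b. \<lbrakk>a \<in> carrier A; b \<in> carrier A\<rbrakk> \<Longrightarrow>
      F (Poly_Mapping.single (a, smult A c b) 1 - Poly_Mapping.single (a, b) c) \<in> U"
  shows "F p \<in> U"
  by (rule linear_span[OF assms(1,2) _ assms(3)[unfolded tensor_rel_def]]) (use assms(4-) in blast)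


section \<open>Primitive elements\<close>

text \<open>The multiplication \<open>S(V) \<otimes> S(V) \<rightarrow> S(V)\<close>, lifted to words. The choice of
  representatives is immaterial modulo the relations, and staying in a free vector space avoids
  linear algebra on the set of classes.\<close>

definition tensor_mult ::
  "((('v list \<Rightarrow>\<^sub>0 'k::field) set \<times> ('v list \<Rightarrow>\<^sub>0 'k) set) \<Rightarrow>\<^sub>0 'k) \<Rightarrow> ('v list \<Rightarrow>\<^sub>0 'k)"
  where "tensor_mult = lin_ext (\<lambda>(X, Y). (SOME a. a \<in> X) \<odot> (SOME b. b \<in> Y))"

lemma linear_tensor_mult: "Vector_Spaces.linear pscale pscale tensor_mult"
  unfolding tensor_mult_def by (rule linear_intros)

lemmas tensor_mult_simps [simp] = linearD[OF linear_tensor_mult]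

lemma representative: "(SOME a'. a' \<in> sym_class s a) - a \<in> sym_rel s"
  using someI[of "\<lambda>a'. a' \<in> sym_class s a", OF self_in_quot_class[OF subspace_sym_rel]]
  by (simp add: in_quot_class_iff)

lemma sym_rel_conc_cong:
  assumes "a - a' \<in> sym_rel s" "b - b' \<in> sym_rel s"
  shows "a \<odot> b - a' \<odot> b' \<in> sym_rel s"
proof -
  have "(a - a') \<odot> b + a' \<odot> (b - b') \<in> sym_rel s"
    by (intro sym_rel_add sym_rel_conc_left sym_rel_conc_right assms)
  then show ?thesis by simp
qed

lemma tensor_mult_single:
  "tensor_mult (Poly_Mapping.single (sym_class s a, sym_class s b) c) - pscale c (a \<odot> b) \<in> sym_rel s"
  using sym_rel_scale[OF sym_rel_conc_cong[OF representative representative]]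
  by (simp add: tensor_mult_def free.scale_right_diff_distrib)

lemma tensor_mult_tensor_rel:
  assumes "p \<in> tensor_rel (sym_vsp s)" shows "tensor_mult p \<in> sym_rel s"
proof (rule linear_tensor_rel[OF linear_tensor_mult subspace_sym_rel assms];
    unfold carrier_sym_vsp; elim rangeE; simp only: add_sym_vsp smult_sym_vsp)
  let ?t = "\<lambda>a b c. Poly_Mapping.single (sym_class s a, sym_class s b) c"
  note T = tensor_mult_single[of s]
  fix a a' b c
  show "tensor_mult (?t (a + a') b 1 - ?t a b 1 - ?t a' b 1) \<in> sym_rel s"
    using sym_rel_diff[OF sym_rel_diff[OF T T] T, of "a + a'" b 1 a b 1 a' b 1] by (simp add: algebra_simps)
  show "tensor_mult (?t a (b + a') 1 - ?t a b 1 - ?t a a' 1) \<in> sym_rel s"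
    using sym_rel_diff[OF sym_rel_diff[OF T T] T, of a "b + a'" 1 a b 1 a a' 1] by (simp add: algebra_simps)
  show "tensor_mult (?t (pscale c a) b 1 - ?t a b c) \<in> sym_rel s"
    using sym_rel_diff[OF T T, of "pscale c a" b 1 a b c] by simp
  show "tensor_mult (?t a (pscale c b) 1 - ?t a b c) \<in> sym_rel s"
    using sym_rel_diff[OF T T, of a "pscale c b" 1 a b c] by simp
qed

lemma word_comult_Cons:
  "word_comult (x # xs) =
    lin_ext (\<lambda>(u, w). Poly_Mapping.single (x # u, w) 1 + Poly_Mapping.single (u, x # w) 1) (word_comult xs)"
  by (simp add: bilin_ext_def lin_ext_add_fun[symmetric] split_def)

declare word_comult.simps(2) [simp del]

text \<open>Each letter of a word of length \<open>n\<close> goes to one of the two tensor factors, and after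
  multiplying, all \<open>2\<^sup>n\<close> resulting words are equal up to the order of their letters.\<close>

lemma tensor_mult_comult_lift:
  fixes s :: "'k::field \<Rightarrow> 'v::ab_group_add \<Rightarrow> 'v"
  shows "tensor_mult (comult_lift s a) - grade_scale (\<lambda>n. 2 ^ n) a \<in> sym_rel s"
proof -
  let ?cat = "lin_ext (\<lambda>(u, w). word (u @ w)) :: ('v list \<times> 'v list \<Rightarrow>\<^sub>0 'k) \<Rightarrow> _"
  have cat: "tensor_mult (lin_ext (\<lambda>(u, w). Poly_Mapping.single (sym_class s (word u), sym_class s (word w)) 1) p)
      - ?cat p \<in> sym_rel s" for p
  proof (rule linear_in_subspace[where p = p, OF _ subspace_sym_rel],
      rule linear_diff_fun, rule linear_comp_fun[OF _ linear_tensor_mult], (rule linear_lin_ext)+, clarify)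
    fix u w
    show "tensor_mult (lin_ext (\<lambda>(u, w). Poly_Mapping.single (sym_class s (word u), sym_class s (word w)) 1)
        (Poly_Mapping.single (u, w) 1)) - ?cat (Poly_Mapping.single (u, w) 1) \<in> sym_rel s"
      using tensor_mult_single[of s "word u" "word w" 1] by simp
  qed
  have words: "?cat (word_comult xs) - pscale (2 ^ length xs) (word xs) \<in> sym_rel s" for xs :: "'v list"
  proof (induction xs)
    case Nil
    show ?case by (simp add: free.subspace_0)
  next
    case (Cons x xs)
    have move: "lin_ext (\<lambda>(u, w). word (x # u @ w) + word (u @ x # w)) p - pscale 2 (word [x] \<odot> ?cat p) \<in> sym_rel s"
      for p
    proof (rule linear_in_subspace[where p = p, OF _ subspace_sym_rel], (rule linear_intros)+, clarify)
      fix u w :: "'v list"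
      have "(word u \<odot> word [x] - word [x] \<odot> word u) \<odot> word w \<in> sym_rel s"
        by (intro sym_rel_conc_right conc_commute)
      moreover have "pscale (2::'k) (word (x # u @ w)) = word (x # u @ w) + word (x # u @ w)"
        by (simp add: single_add[symmetric])
      ultimately show "lin_ext (\<lambda>(u, w). word (x # u @ w) + word (u @ x # w)) (Poly_Mapping.single (u, w) 1)
          - pscale 2 (word [x] \<odot> ?cat (Poly_Mapping.single (u, w) 1)) \<in> sym_rel s"
        by (simp del: pscale_single)
    qed
    have "?cat (word_comult (x # xs)) = lin_ext (\<lambda>(u, w). word (x # u @ w) + word (u @ x # w)) (word_comult xs)"
      by (simp add: word_comult_Cons lin_ext_linear[OF linear_lin_ext] split_def)
    moreover have IH: "pscale 2 (word [x] \<odot> (?cat (word_comult xs) - pscale (2 ^ length xs) (word xs))) \<in> sym_rel s"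
      by (intro sym_rel_scale sym_rel_conc_left Cons)
    ultimately show ?case
      using sym_rel_add[OF move[of "word_comult xs"] IH] by (simp add: free.scale_right_diff_distrib)
  qed
  show ?thesis
  proof (rule linear_in_subspace[where p = a, OF _ subspace_sym_rel])
    show "Vector_Spaces.linear pscale pscale (\<lambda>a. tensor_mult (comult_lift s a) - grade_scale (\<lambda>n. 2 ^ n) a)"
      by (intro linear_diff_fun linear_comp_fun[OF linear_comult_lift linear_tensor_mult] linear_grade_scale)
    fix xs
    show "tensor_mult (comult_lift s (word xs)) - grade_scale (\<lambda>n. 2 ^ n) (word xs) \<in> sym_rel s"
      using sym_rel_add[OF cat words[of xs], of "word_comult xs"] by (simp add: comult_lift_def)
  qed
qed

lemma two_power_eq_two_iff: "(2::'k::field_char_0) ^ n = 2 \<longleftrightarrow> n = 1"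
proof -
  have "(2::'k) ^ n = 2 \<longleftrightarrow> of_nat (2 ^ n) = (of_nat 2 :: 'k)" by simp
  also have "\<dots> \<longleftrightarrow> (2::nat) ^ n = 2 ^ 1" by (simp only: of_nat_eq_iff power_one_right)
  also have "\<dots> \<longleftrightarrow> n = 1" by (rule power_inject_exp) simp
  finally show ?thesis .
qed

text \<open>Multiplying out the equation for a primitive element gives that \<open>(2\<^sup>n - 2) a\<^sub>n = 0\<close> for
  the component \<open>a\<^sub>n\<close> of each degree \<open>n\<close>, and \<open>2\<^sup>n - 2\<close> is invertible for \<open>n \<noteq> 1\<close>.\<close>

lemma primitive_letter:
  fixes s :: "'k::field_char_0 \<Rightarrow> 'v::ab_group_add \<Rightarrow> 'v"
  assumes "vector_space s"
    and prim: "comult_lift s a - (Poly_Mapping.single (sym_class s a, sym_class s (word [])) 1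
      + Poly_Mapping.single (sym_class s (word []), sym_class s a) 1) \<in> tensor_rel (sym_vsp s)"
  shows "sym_class s a = sym_class s (word [letter_part s a])"
proof -
  let ?t = "\<lambda>a b. tensor_mult (Poly_Mapping.single (sym_class s a, sym_class s b) 1)"
  have 1: "tensor_mult (comult_lift s a) - (?t a (word []) + ?t (word []) a) \<in> sym_rel s"
    using tensor_mult_tensor_rel[OF prim] by simp
  have 2: "?t a (word []) - a \<in> sym_rel s" "?t (word []) a - a \<in> sym_rel s"
    using tensor_mult_single[of s a "word []" 1] tensor_mult_single[of s "word []" a 1] by simp_all
  have "tensor_mult (comult_lift s a) - (?t a (word []) + ?t (word []) a)
      + (?t a (word []) - a) + (?t (word []) a - a)
      - (tensor_mult (comult_lift s a) - grade_scale (\<lambda>n. 2 ^ n) a) \<in> sym_rel s"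
    by (intro sym_rel_add sym_rel_diff 1 2 tensor_mult_comult_lift)
  also have "tensor_mult (comult_lift s a) - (?t a (word []) + ?t (word []) a)
      + (?t a (word []) - a) + (?t (word []) a - a)
      - (tensor_mult (comult_lift s a) - grade_scale (\<lambda>n. 2 ^ n) a)
      = grade_scale (\<lambda>n. 2 ^ n) a - (a + a)"
    by simp
  also have "a + a = grade_scale (\<lambda>_. 2) a"
    using free.scale_left_distrib[of 1 1 a] by (simp add: grade_scale_const)
  finally have "grade_scale (\<lambda>n. 2 ^ n - 2) a \<in> sym_rel s"
    by (simp add: grade_scale_diff)
  \<comment> \<open>In degree one the divisor is zero and so is the quotient, which leaves that component out.\<close>
  from grade_scale_sym_rel[OF this, of "\<lambda>n. 1 / (2 ^ n - 2)"]
  have "grade_scale (\<lambda>n. 1 - (if n = 1 then 1 else 0)) a \<in> sym_rel s"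
    by (simp add: grade_scale_grade_scale two_power_eq_two_iff if_distrib cong: if_cong)
  then have "a - grade_scale (\<lambda>n. if n = 1 then 1 else 0) a \<in> sym_rel s"
    using grade_scale_diff[of "\<lambda>_. 1" a] by (simp add: grade_scale_const)
  from sym_rel_add[OF this degree_one_part[OF assms(1), of a]]
  show ?thesis by (simp add: sym_class_eq_iff)
qed

section \<open>Restriction of isomorphisms to letters\<close>

text \<open>The map \<open>S(\<psi>)\<close>, on representatives.\<close>

definition sym_map :: "('v \<Rightarrow> 'w) \<Rightarrow> ('v list \<Rightarrow>\<^sub>0 'k::field) \<Rightarrow> ('w list \<Rightarrow>\<^sub>0 'k)"
  where "sym_map \<psi> = lin_ext (\<lambda>w. word (map \<psi> w))"

lemma linear_sym_map [linear_intros]: "Vector_Spaces.linear pscale pscale (sym_map \<psi>)"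
  unfolding sym_map_def by (rule linear_intros)

lemmas sym_map_simps [simp] = linearD[OF linear_sym_map]

lemma sym_map_single [simp]: "sym_map \<psi> (Poly_Mapping.single w c) = Poly_Mapping.single (map \<psi> w) c"
  by (simp add: sym_map_def)

lemma letter_part_sym_map:
  assumes "Vector_Spaces.linear s t \<psi>"
  shows "letter_part t (sym_map \<psi> a) = \<psi> (letter_part s a)"
proof -
  have s: "vector_space s" and t: "vector_space t"
    using assms unfolding Vector_Spaces.linear_iff by blast+
  interpret s: vector_space s by (rule s)
  interpret t: vector_space t by (rule t)
  note lin = linear_letter_part[OF s] linear_letter_part[OF t]
  show ?thesis
    by (rule linear_eqI[where p = a and t = t], rule linear_comp_fun[OF linear_sym_map lin(2)],
        rule linear_comp_fun[OF lin(1) assms])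
      (simp add: letter_part_single s t linearD[OF assms] split: list.split)
qed

text \<open>Injectivity of \<open>\<psi>\<close> is inherited from \<open>\<phi>\<close>. For surjectivity, a letter \<open>w\<close> is
  \<open>\<phi>\<close> of some class, and \<open>\<phi> = S(\<psi>)\<close> identifies \<open>w\<close> with the image under \<open>\<psi>\<close> of its
  degree one part; this avoids showing that the inverse of \<open>\<phi>\<close> preserves the coproduct.\<close>

lemma iso_on_letters:
  fixes sV :: "'k::field_char_0 \<Rightarrow> 'v::ab_group_add \<Rightarrow> 'v"
    and sW :: "'k \<Rightarrow> 'w::ab_group_add \<Rightarrow> 'w"
  assumes V: "vector_space sV" and W: "vector_space sW"
    and iso: "cpl_bialgebra_iso (S_bialgebra sV f lam) (S_bialgebra sW g mu) \<phi>"
  obtains \<psi> where "Vector_Spaces.linear sV sW \<psi>" "bij \<psi>"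
    "\<And>v. \<phi> (sym_class sV (word [v])) = sym_class sW (word [\<psi> v])"
proof -
  interpret V: vector_space sV by fact
  interpret W: vector_space sW by fact
  let ?c = "sym_class sV" and ?d = "sym_class sW"
  have bij: "bij_betw \<phi> (range ?c) (range ?d)"
    and add: "\<And>a b. \<phi> (?c (a + b)) = add (sym_vsp sW) (\<phi> (?c a)) (\<phi> (?c b))"
    and smult: "\<And>k a. \<phi> (?c (pscale k a)) = smult (sym_vsp sW) k (\<phi> (?c a))"
    and mult: "\<And>a b. \<phi> (?c (a \<odot> b)) = mult (S_bialgebra sW g mu) (\<phi> (?c a)) (\<phi> (?c b))"
    and one: "\<phi> (?c (word [])) = ?d (word [])"
    and comult: "\<And>a. comult (S_bialgebra sW g mu) (\<phi> (?c a)) =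
      tensor_map (S_bialgebra sW g mu) \<phi> (comult (S_bialgebra sV f lam) (?c a))"
    using iso unfolding cpl_bialgebra_iso_def
    by (simp_all add: add_sym_vsp[symmetric] smult_sym_vsp[symmetric] mult_S_bialgebra[where f = f and lam = lam, symmetric])
  \<comment> \<open>The image of a letter is primitive.\<close>
  have "\<exists>w. \<phi> (?c (word [v])) = ?d (word [w])" for v
  proof -
    have "\<phi> (?c (word [v])) \<in> range ?d"
      using bij_betwE[OF bij] by blast
    then obtain b where b: "\<phi> (?c (word [v])) = ?d b" by auto
    let ?t = "comult_lift sV (word [v])"
    let ?t' = "lin_ext (\<lambda>(a, b). Poly_Mapping.single (\<phi> a, \<phi> b) 1) ?t"
    have "?t \<in> comult (S_bialgebra sV f lam) (?c (word [v]))"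
      unfolding comult_S_bialgebra
      by (blast intro: self_in_quot_class subspace_sym_rel subspace_tensor_rel)
    then have "?t' \<in> tensor_map (S_bialgebra sW g mu) \<phi> (comult (S_bialgebra sV f lam) (?c (word [v])))"
      unfolding tensor_map_def
      by (blast intro: self_in_quot_class subspace_tensor_rel)
    then have "?t' \<in> comult (S_bialgebra sW g mu) (?d b)"
      by (simp add: comult[symmetric] b)
    then obtain a where a: "a - b \<in> sym_rel sW"
      and t': "?t' - comult_lift sW a \<in> tensor_rel (sym_vsp sW)"
      unfolding comult_S_bialgebra by (auto simp: in_quot_class_iff)
    have ab: "?d a = ?d b" using a by (simp add: sym_class_eq_iff)
    have "?t' = Poly_Mapping.single (?d a, ?d (word [])) 1 + Poly_Mapping.single (?d (word []), ?d a) 1"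
      by (simp add: comult_lift_def word_comult_Cons one b ab)
    then have "comult_lift sW a - (Poly_Mapping.single (?d a, ?d (word [])) 1
        + Poly_Mapping.single (?d (word []), ?d a) 1) \<in> tensor_rel (sym_vsp sW)"
      using free.subspace_neg[OF subspace_tensor_rel t'] by simp
    from primitive_letter[OF W this] show ?thesis using b ab by auto
  qed
  then obtain \<psi> where \<psi>: "\<And>v. \<phi> (?c (word [v])) = ?d (word [\<psi> v])" by metis
  have lin: "Vector_Spaces.linear sV sW \<psi>"
    unfolding Vector_Spaces.linear_iff
  proof (intro conjI allI V W)
    fix u v k
    have "?d (word [\<psi> (u + v)]) = ?d (word [\<psi> u + \<psi> v])"
      by (simp only: \<psi>[symmetric] sym_class_letter add) (simp only: \<psi> add_sym_vsp sym_class_letter)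
    then show "\<psi> (u + v) = \<psi> u + \<psi> v" by (rule sym_class_letter_inj[OF W])
    have "?d (word [\<psi> (sV k v)]) = ?d (word [sW k (\<psi> v)])"
      by (simp only: \<psi>[symmetric] sym_class_letter smult) (simp only: \<psi> smult_sym_vsp sym_class_letter)
    then show "\<psi> (sV k v) = sW k (\<psi> v)" by (rule sym_class_letter_inj[OF W])
  qed
  have \<phi>_eq: "\<phi> (?c a) = ?d (sym_map \<psi> a)" for a
  proof -
    have words: "\<phi> (?c (word xs)) = ?d (word (map \<psi> xs))" for xs
    proof (induction xs)
      case (Cons x xs)
      have "\<phi> (?c (word (x # xs))) = ?d (word [\<psi> x] \<odot> word (map \<psi> xs))"
        by (simp only: word_Cons[of x xs] mult Cons.IH \<psi> mult_S_bialgebra)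
      then show ?case by simp
    qed (simp add: one)
    have "a \<in> {a. \<phi> (?c a) = ?d (sym_map \<psi> a)}"
    proof (rule free_subspace_all, rule free.subspaceI)
      obtain b where b: "\<phi> (?c 0) = ?d b"
        using bij_betwE[OF bij] by blast
      have "\<phi> (?c (pscale 0 0)) = ?d (pscale 0 b)"
        by (simp only: smult b smult_sym_vsp)
      then show "0 \<in> {a. \<phi> (?c a) = ?d (sym_map \<psi> a)}" by simp
    qed (simp_all add: add add_sym_vsp smult smult_sym_vsp words)
    then show ?thesis by simp
  qed
  have "inj \<psi>"
  proof (rule injI)
    fix u v assume "\<psi> u = \<psi> v"
    then have "\<phi> (?c (word [u])) = \<phi> (?c (word [v]))" by (simp add: \<psi>)
    then have "?c (word [u]) = ?c (word [v])"
      using bij by (auto simp: bij_betw_def dest: inj_onD)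
    then show "u = v" by (rule sym_class_letter_inj[OF V])
  qed
  moreover have "w \<in> range \<psi>" for w
  proof -
    have "?d (word [w]) \<in> \<phi> ` range ?c"
      using bij by (simp add: bij_betw_def)
    then obtain a where "?d (word [w]) = ?d (sym_map \<psi> a)"
      by (auto simp: \<phi>_eq)
    then have "letter_part sW (word [w] - sym_map \<psi> a) = 0"
      by (intro letter_part_sym_rel[OF W]) (simp add: sym_class_eq_iff)
    then have "w = \<psi> (letter_part sV a)"
      by (simp add: letter_part_simps[OF W] letter_part_single[OF W] letter_part_sym_map[OF lin])
    then show ?thesis by simp
  qed
  ultimately have "bij \<psi>" by (auto simp: bij_def)
  with lin \<psi> show thesis using that by blast
qed

lemma bullet_letter_word:
  "bilin_ext (word_bullet f lam) (word [x]) (word [y]) = pscale (f x) (word [y])"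
  "bilin_ext (word_bullet f lam) (word [x]) (word [y, y]) =
    pscale (f x) (word [y, y] + pscale (2 * lam * f y) (word [y]))"
  by (simp_all add: bullet_letter bullet_kernel_def single_add[symmetric] algebra_simps del: bullet_words)

lemma iso_parameters:
  fixes sV :: "'k::field_char_0 \<Rightarrow> 'v::ab_group_add \<Rightarrow> 'v"
    and sW :: "'k \<Rightarrow> 'w::ab_group_add \<Rightarrow> 'w"
  assumes V: "vector_space sV" and W: "vector_space sW"
    and f: "Vector_Spaces.linear sV (*) f" and g: "Vector_Spaces.linear sW (*) g"
    and iso: "cpl_bialgebra_iso (S_bialgebra sV f lam) (S_bialgebra sW g mu) \<phi>"
    and \<psi>: "Vector_Spaces.linear sV sW \<psi>" "bij \<psi>"
      "\<And>v. \<phi> (sym_class sV (word [v])) = sym_class sW (word [\<psi> v])"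
  shows "g \<circ> \<psi> = f" "\<And>x. f x \<noteq> 0 \<Longrightarrow> lam = mu"
proof -
  interpret V: vector_space sV by fact
  interpret W: vector_space sW by fact
  let ?c = "sym_class sV" and ?d = "sym_class sW"
  let ?D = "bilin_ext (word_bullet f lam)"
  have add: "\<And>a b. \<phi> (?c (a + b)) = add (sym_vsp sW) (\<phi> (?c a)) (\<phi> (?c b))"
    and smult: "\<And>k a. \<phi> (?c (pscale k a)) = smult (sym_vsp sW) k (\<phi> (?c a))"
    and mult: "\<And>a b. \<phi> (?c (a \<odot> b)) = mult (S_bialgebra sW g mu) (\<phi> (?c a)) (\<phi> (?c b))"
    and bullet: "\<And>a b. \<phi> (?c (?D a b)) = bullet (S_bialgebra sW g mu) (\<phi> (?c a)) (\<phi> (?c b))"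
    using iso unfolding cpl_bialgebra_iso_def
    by (simp_all add: add_sym_vsp[symmetric] smult_sym_vsp[symmetric] mult_S_bialgebra[where f = f and lam = lam, symmetric]
        bullet_S_bialgebra[OF f, symmetric])
  have square: "\<phi> (?c (word [y, y])) = ?d (word [\<psi> y, \<psi> y])" for y
  proof -
    have "\<phi> (?c (word [y] \<odot> word [y])) = ?d (word [\<psi> y] \<odot> word [\<psi> y])"
      by (simp only: mult \<psi>(3) mult_S_bialgebra)
    then show ?thesis by simp
  qed
  note letter = letter_part_simps[OF W] letter_part_single[OF W]
  have "sW (f x) (\<psi> y) = sW (g (\<psi> x)) (\<psi> y)" for x y
  proof -
    have "?d (pscale (f x) (word [\<psi> y])) = \<phi> (?c (?D (word [x]) (word [y])))"
      by (simp only: bullet_letter_word smult \<psi>(3) smult_sym_vsp)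
    also have "\<dots> = ?d (pscale (g (\<psi> x)) (word [\<psi> y]))"
      by (simp only: bullet) (simp only: \<psi>(3) bullet_S_bialgebra[OF g] bullet_letter_word)
    finally have "letter_part sW (pscale (f x) (word [\<psi> y])) = letter_part sW (pscale (g (\<psi> x)) (word [\<psi> y]))"
      by (rule letter_part_class[OF W])
    then show ?thesis by (simp add: letter)
  qed
  then have cancel: "f x = g (\<psi> x) \<or> \<psi> y = 0" for x y by simp
  \<comment> \<open>Take \<open>y = x\<close>; if \<open>\<psi> x = 0\<close>, then \<open>x = 0\<close> and both values vanish.\<close>
  have f_eq: "f x = g (\<psi> x)" for x
    using cancel[of x x] \<psi>(2) linearD(3)[OF \<psi>(1)] linearD(3)[OF f] linearD(3)[OF g]
    by (metis bij_pointE)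
  then show "g \<circ> \<psi> = f" by auto
  show "lam = mu" if fx: "f x \<noteq> 0" for x
  proof -
    have "?d (pscale (f x) (word [\<psi> x, \<psi> x] + pscale (2 * lam * f x) (word [\<psi> x])))
        = \<phi> (?c (?D (word [x]) (word [x, x])))"
      by (simp only: bullet_letter_word smult add square \<psi>(3) smult_sym_vsp add_sym_vsp)
    also have "\<dots> = ?d (pscale (g (\<psi> x)) (word [\<psi> x, \<psi> x] + pscale (2 * mu * g (\<psi> x)) (word [\<psi> x])))"
      by (simp only: bullet) (simp only: square \<psi>(3) bullet_S_bialgebra[OF g] bullet_letter_word)
    finally have "letter_part sW (pscale (f x) (word [\<psi> x, \<psi> x] + pscale (2 * lam * f x) (word [\<psi> x])))
        = letter_part sW (pscale (f x) (word [\<psi> x, \<psi> x] + pscale (2 * mu * f x) (word [\<psi> x])))"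
      unfolding f_eq[symmetric] by (rule letter_part_class[OF W])
    moreover have "\<psi> x \<noteq> 0" using fx f_eq[of x] linearD(3)[OF g] by auto
    ultimately show ?thesis using fx by (simp add: letter)
  qed
qed

section \<open>Functoriality of the symmetric algebra\<close>

lemma linear_inv:
  assumes "Vector_Spaces.linear s t \<psi>" "bij \<psi>"
  shows "Vector_Spaces.linear t s (inv \<psi>)"
  using bij_module_hom_imp_inv_module_hom[OF module_hom_linearI[OF assms(1)] assms(2)]
  by (simp only: module_hom_iff_linear)

lemma sym_map_comp: "sym_map \<chi> (sym_map \<psi> a) = sym_map (\<chi> \<circ> \<psi>) a"
  unfolding sym_map_def
  by (rule free_eqI[where p = a], (rule linear_intros)+, simp add: o_def)

lemma sym_map_id: "sym_map id a = a"
  by (simp add: sym_map_def lin_ext_basis)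

lemma sym_map_conc: "sym_map \<psi> (a \<odot> b) = sym_map \<psi> a \<odot> sym_map \<psi> b"
proof -
  have words: "sym_map \<psi> (word u \<odot> b) = sym_map \<psi> (word u) \<odot> sym_map \<psi> b" for u
    unfolding sym_map_def
    by (rule free_eqI[where p = b], (rule linear_intros)+, simp)
  show ?thesis
    unfolding sym_map_def
    by (rule free_eqI[where p = a], (rule linear_intros)+, rule words[unfolded sym_map_def])
qed

lemma sym_map_sym_rel:
  assumes "Vector_Spaces.linear s t \<psi>" "a \<in> sym_rel s"
  shows "sym_map \<psi> a \<in> sym_rel t"
proof (rule linear_sym_rel[OF linear_sym_map subspace_sym_rel assms(2)])
  fix p q r assume "r \<in> letter_rel s"
  then have "sym_map \<psi> r \<in> letter_rel t"
    by (cases rule: letter_relE) (auto simp: letter_rel_def linearD[OF assms(1)])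
  then show "sym_map \<psi> (word p \<odot> r \<odot> word q) \<in> sym_rel t"
    by (simp add: sym_map_conc sym_rel_conc_left sym_rel_conc_right letter_rel_sym_rel)
qed

text \<open>As \<open>S(\<psi>)\<close> is bijective on representatives and matches the relations on both sides, the
  direct image of a coset is a coset. This makes the direct image itself the isomorphism.\<close>

lemma sym_map_image_class:
  assumes "Vector_Spaces.linear s t \<psi>" "bij \<psi>"
  shows "sym_map \<psi> ` sym_class s a = sym_class t (sym_map \<psi> a)"
proof
  show "sym_map \<psi> ` sym_class s a \<subseteq> sym_class t (sym_map \<psi> a)"
    using sym_map_sym_rel[OF assms(1)] by (fastforce simp: in_quot_class_iff simp flip: sym_map_simps)
next
  have inverse: "\<psi> \<circ> inv \<psi> = id" "inv \<psi> \<circ> \<psi> = id"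
    using assms(2) by (simp_all add: bij_is_surj bij_is_inj surj_iff[symmetric] inj_iff[symmetric])
  show "sym_class t (sym_map \<psi> a) \<subseteq> sym_map \<psi> ` sym_class s a"
  proof
    fix b assume "b \<in> sym_class t (sym_map \<psi> a)"
    then have "sym_map (inv \<psi>) (b - sym_map \<psi> a) \<in> sym_rel s"
      by (intro sym_map_sym_rel[OF linear_inv[OF assms]]) (simp add: in_quot_class_iff)
    then have "sym_map (inv \<psi>) b \<in> sym_class s a"
      by (simp add: in_quot_class_iff sym_map_comp inverse sym_map_id)
    moreover have "b = sym_map \<psi> (sym_map (inv \<psi>) b)"
      by (simp add: sym_map_comp inverse sym_map_id)
    ultimately show "b \<in> sym_map \<psi> ` sym_class s a" by blast
  qed
qed

lemma sym_map_grade_scale: "sym_map \<psi> (grade_scale c a) = grade_scale c (sym_map \<psi> a)"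
  unfolding sym_map_def grade_scale_def
  by (rule free_eqI[where p = a], (rule linear_intros)+, simp)

text \<open>The form \<open>f\<close> enters the product only through its values on letters, so \<open>S(\<psi>)\<close> intertwines
  the products of \<open>g \<circ> \<psi>\<close> and \<open>g\<close> for every map \<open>\<psi>\<close>.\<close>

lemma sym_map_bullet:
  "sym_map \<psi> (bilin_ext (word_bullet (g \<circ> \<psi>) lam) a b) =
    bilin_ext (word_bullet g lam) (sym_map \<psi> a) (sym_map \<psi> b)"
proof -
  have "sym_map \<psi> (contraction (g \<circ> \<psi>) lam ys n) = contraction g lam (map \<psi> ys) n" for ys n
    by (induction ys arbitrary: n) (simp_all add: sym_map_conc)
  then have "sym_map \<psi> (letter_bullet (g \<circ> \<psi>) lam x ys) = letter_bullet g lam (\<psi> x) (map \<psi> ys)" for x ys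
    by (simp add: letter_bullet_eq bullet_kernel_def sym_map_grade_scale)
  then have 1: "sym_map \<psi> (word_bullet (g \<circ> \<psi>) lam xs ys) = word_bullet g lam (map \<psi> xs) (map \<psi> ys)" for xs ys
    by (induction xs) (simp_all add: word_bullet_Cons sym_map_conc)
  have 2: "sym_map \<psi> (bilin_ext (word_bullet (g \<circ> \<psi>) lam) (word xs) b) =
    bilin_ext (word_bullet g lam) (sym_map \<psi> (word xs)) (sym_map \<psi> b)" for xs
    unfolding sym_map_def
    by (rule free_eqI[where p = b], (rule linear_intros)+)
      (simp only: bullet_words lin_ext_single free.scale_one 1[unfolded sym_map_def])
  show ?thesis
    unfolding sym_map_def
    by (rule free_eqI[where p = a], (rule linear_intros)+, rule 2[unfolded sym_map_def])
qed

lemma word_comult_map: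
  "word_comult (map \<psi> xs) =
    lin_ext (\<lambda>(u, w). Poly_Mapping.single (map \<psi> u, map \<psi> w) 1) (word_comult xs)"
proof (induction xs)
  case (Cons x xs)
  show ?case
    by (simp add: word_comult_Cons Cons.IH lin_ext_linear[OF linear_lin_ext] split_def)
qed simp

lemma comult_lift_sym_map:
  assumes "Vector_Spaces.linear s t \<psi>" "bij \<psi>"
  shows "comult_lift t (sym_map \<psi> a) =
    lin_ext (\<lambda>(X, Y). Poly_Mapping.single (sym_map \<psi> ` X, sym_map \<psi> ` Y) 1) (comult_lift s a)"
proof (rule free_eqI[where p = a])
  show "Vector_Spaces.linear pscale pscale (\<lambda>a. comult_lift t (sym_map \<psi> a))"
    "Vector_Spaces.linear pscale pscale
      (\<lambda>a. lin_ext (\<lambda>(X, Y). Poly_Mapping.single (sym_map \<psi> ` X, sym_map \<psi> ` Y) 1) (comult_lift s a))"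
    by (rule linear_comp_fun[OF linear_sym_map linear_comult_lift] linear_comp_fun[OF linear_comult_lift linear_lin_ext])+
  fix xs
  show "comult_lift t (sym_map \<psi> (word xs)) =
    lin_ext (\<lambda>(X, Y). Poly_Mapping.single (sym_map \<psi> ` X, sym_map \<psi> ` Y) 1) (comult_lift s (word xs))"
    by (simp add: comult_lift_def word_comult_map lin_ext_linear[OF linear_lin_ext] split_def
        sym_map_image_class[OF assms])
qed

lemma tensor_relI:
  "\<lbrakk>a \<in> carrier A; a' \<in> carrier A; b \<in> carrier A\<rbrakk> \<Longrightarrow>
    Poly_Mapping.single (add A a a', b) 1 - Poly_Mapping.single (a, b) 1
      - Poly_Mapping.single (a', b) 1 \<in> tensor_rel A"
  "\<lbrakk>a \<in> carrier A; b \<in> carrier A; b' \<in> carrier A\<rbrakk> \<Longrightarrow>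
    Poly_Mapping.single (a, add A b b') 1 - Poly_Mapping.single (a, b) 1
      - Poly_Mapping.single (a, b') 1 \<in> tensor_rel A"
  "\<lbrakk>a \<in> carrier A; b \<in> carrier A\<rbrakk> \<Longrightarrow>
    Poly_Mapping.single (smult A c a, b) 1 - Poly_Mapping.single (a, b) c \<in> tensor_rel A"
  "\<lbrakk>a \<in> carrier A; b \<in> carrier A\<rbrakk> \<Longrightarrow>
    Poly_Mapping.single (a, smult A c b) 1 - Poly_Mapping.single (a, b) c \<in> tensor_rel A"
  unfolding tensor_rel_def by (rule free.span_base, blast)+

lemma tensor_rel_map:
  assumes add: "\<And>a b. a \<in> carrier A \<Longrightarrow> b \<in> carrier A \<Longrightarrow> \<phi> (add A a b) = add B (\<phi> a) (\<phi> b)"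
    and smult: "\<And>c a. a \<in> carrier A \<Longrightarrow> \<phi> (smult A c a) = smult B c (\<phi> a)"
    and carrier: "\<And>a. a \<in> carrier A \<Longrightarrow> \<phi> a \<in> carrier B"
    and p: "p \<in> tensor_rel A"
  shows "lin_ext (\<lambda>(a, b). Poly_Mapping.single (\<phi> a, \<phi> b) 1) p \<in> tensor_rel B"
  by (rule linear_tensor_rel[OF linear_lin_ext subspace_tensor_rel p])
    (simp_all add: add smult carrier tensor_relI)

text \<open>On classes, every operation is given by a formula on words with which \<open>S(\<psi>)\<close> commutes. For the
  coproduct, the union over all representatives in \<^const>\<open>tensor_map\<close> still has to be collapsed; this works because
  \<open>\<phi> \<otimes> \<phi>\<close> preserves the relations of the tensor square.\<close>

lemma iso_sym_map:
  fixes sV :: "'k::field_char_0 \<Rightarrow> 'v::ab_group_add \<Rightarrow> 'v"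
    and sW :: "'k \<Rightarrow> 'w::ab_group_add \<Rightarrow> 'w"
  assumes \<psi>: "Vector_Spaces.linear sV sW \<psi>" "bij \<psi>"
    and f: "Vector_Spaces.linear sV (*) f" and g: "Vector_Spaces.linear sW (*) g" and gf: "g \<circ> \<psi> = f"
  shows "cpl_bialgebra_iso (S_bialgebra sV f lam) (S_bialgebra sW g lam) ((`) (sym_map \<psi>))"
proof -
  let ?\<phi> = "(`) (sym_map \<psi>)"
  let ?\<Phi> = "lin_ext (\<lambda>(X, Y). Poly_Mapping.single (?\<phi> X, ?\<phi> Y) 1)"
  note on_classes = sym_map_image_class[OF \<psi>]
  have inverse: "\<psi> \<circ> inv \<psi> = id" "inv \<psi> \<circ> \<psi> = id"
    using \<psi>(2) by (simp_all add: bij_is_surj bij_is_inj surj_iff[symmetric] inj_iff[symmetric])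
  have inj: "inj (sym_map \<psi> :: ('v list \<Rightarrow>\<^sub>0 'k) \<Rightarrow> _)"
    by (rule inj_on_inverseI[of _ "sym_map (inv \<psi>)"]) (simp add: sym_map_comp inverse sym_map_id)
  have "bij_betw ?\<phi> (range (sym_class sV)) (?\<phi> ` range (sym_class sV))"
    by (intro inj_on_imp_bij_betw inj_onI) (simp add: inj_image_eq_iff[OF inj])
  moreover have "?\<phi> ` range (sym_class sV) = range (sym_class sW)"
  proof -
    have "surj (sym_map \<psi> :: ('v list \<Rightarrow>\<^sub>0 'k) \<Rightarrow> _)"
      by (rule surjI[of _ "sym_map (inv \<psi>)"]) (simp add: sym_map_comp inverse sym_map_id)
    then show ?thesis by (auto simp: image_image on_classes) (metis surjE rangeI)
  qed
  moreover have rel: "?\<Phi> t \<in> tensor_rel (sym_vsp sW)" if "t \<in> tensor_rel (sym_vsp sV)" for t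
    by (rule tensor_rel_map[OF _ _ _ that]; unfold carrier_sym_vsp; elim rangeE;
        simp only: add_sym_vsp smult_sym_vsp on_classes sym_map_simps rangeI)
  have "comult (S_bialgebra sW g lam) (?\<phi> X) =
      tensor_map (S_bialgebra sW g lam) ?\<phi> (comult (S_bialgebra sV f lam) X)" for X
  proof -
    have "(\<Union>t\<in>quot_class (tensor_rel (sym_vsp sV)) (comult_lift sV a). quot_class (tensor_rel (sym_vsp sW)) (?\<Phi> t))
        = quot_class (tensor_rel (sym_vsp sW)) (comult_lift sW (sym_map \<psi> a))" for a
      unfolding comult_lift_sym_map[OF \<psi>]
    proof (rule Union_quot_class[OF subspace_tensor_rel], unfold quot_class_eq_iff[OF subspace_tensor_rel])
      fix q assume "q - comult_lift sV a \<in> tensor_rel (sym_vsp sV)"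
      from rel[OF this] show "?\<Phi> q - ?\<Phi> (comult_lift sV a) \<in> tensor_rel (sym_vsp sW)" by simp
    qed
    then show ?thesis
      by (simp add: comult_S_bialgebra tensor_map_def)
  qed
  moreover have "counit (S_bialgebra sW g lam) (?\<phi> X) = counit (S_bialgebra sV f lam) X" for X
  proof -
    have lin: "Vector_Spaces.linear pscale (*) (\<lambda>p. Poly_Mapping.lookup p x)"
      for x :: 'c
      unfolding Vector_Spaces.linear_iff
      by (simp add: vector_space_pscale lookup_add vector_space_def algebra_simps)
    have "Poly_Mapping.lookup (sym_map \<psi> a) [] = Poly_Mapping.lookup a []" for a :: "'v list \<Rightarrow>\<^sub>0 'k"
      by (rule linear_eqI[where p = a and t = "(*)"], rule linear_comp_fun[OF linear_sym_map lin], rule lin)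
        (simp add: lookup_single when_def)
    then show ?thesis by (simp add: S_bialgebra_def image_image)
  qed
  ultimately show ?thesis
    unfolding cpl_bialgebra_iso_def
    by (auto simp: add_sym_vsp smult_sym_vsp mult_S_bialgebra bullet_S_bialgebra[OF f[folded gf]] bullet_S_bialgebra[OF g]
        on_classes sym_map_conc sym_map_bullet simp flip: gf)
qed

section \<open>Classification\<close>

lemma same_dim_iff:
  assumes V: "vector_space s" and W: "vector_space t"
  shows "same_dim s t \<longleftrightarrow> (\<exists>\<psi>. Vector_Spaces.linear s t \<psi> \<and> bij \<psi>)"
proof
  interpret V: vector_space s by fact
  interpret W: vector_space t by fact
  interpret VW: vector_space_pair s t ..
  interpret WV: vector_space_pair t s ..
  interpret VV: vector_space_pair s s ..
  interpret WW: vector_space_pair t t ..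
  {
    \<comment> \<open>A bijection of bases and its inverse extend to mutually inverse linear maps.\<close>
    assume "same_dim s t"
    then obtain B C h where B: "\<not> V.dependent B" "V.span B = UNIV"
      and C: "\<not> W.dependent C" "W.span C = UNIV" and h: "bij_betw h B C"
      unfolding same_dim_def eqpoll_def by blast
    define \<psi> where "\<psi> = VW.construct B h"
    define \<chi> where "\<chi> = WV.construct C (inv_into B h)"
    have \<psi>: "Vector_Spaces.linear s t \<psi>" and \<chi>: "Vector_Spaces.linear t s \<chi>"
      unfolding \<psi>_def \<chi>_def by (rule VW.linear_construct[OF B(1)] WV.linear_construct[OF C(1)])+
    have "\<chi> (\<psi> b) = b" if "b \<in> B" for b
      using that h bij_betwE[OF h] by (simp add: \<psi>_def \<chi>_def VW.construct_basis[OF B(1)] WV.construct_basis[OF C(1)]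
        bij_betw_inv_into_left)
    then have 1: "\<chi> (\<psi> v) = v" for v
      using VV.linear_eq_on_span[OF linear_comp_fun[OF \<psi> \<chi>] V.linear_ident, of B v] B by simp
    have "\<psi> (\<chi> c) = c" if "c \<in> C" for c
      using that h bij_betwE[OF bij_betw_inv_into[OF h]]
      by (simp add: \<psi>_def \<chi>_def VW.construct_basis[OF B(1)] WV.construct_basis[OF C(1)]
        bij_betw_inv_into_right)
    then have 2: "\<psi> (\<chi> v) = v" for v
      using WW.linear_eq_on_span[OF linear_comp_fun[OF \<chi> \<psi>] W.linear_ident, of C v] C by simp
    have "bij \<psi>" by (rule o_bij[of \<chi>]) (auto simp: 1 2)
    with \<psi> show "\<exists>\<psi>. Vector_Spaces.linear s t \<psi> \<and> bij \<psi>" by blast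
  next
    assume "\<exists>\<psi>. Vector_Spaces.linear s t \<psi> \<and> bij \<psi>"
    then obtain \<psi> where \<psi>: "Vector_Spaces.linear s t \<psi>" "bij \<psi>" by blast
    interpret \<psi>: module_hom s t \<psi> using \<psi>(1) by (simp add: linear_iff_module_hom)
    define B where "B = V.extend_basis {}"
    have B: "\<not> V.dependent B" "V.span B = UNIV"
      using V.independent_extend_basis[OF V.independent_empty] V.span_extend_basis[OF V.independent_empty]
      by (simp_all add: B_def)
    have "W.span (\<psi> ` B) = UNIV"
      using \<psi>(2) by (simp add: \<psi>.span_image B bij_is_surj)
    moreover have "\<not> W.dependent (\<psi> ` B)"
      by (rule VW.linear_independent_injective_image[OF \<psi>(1) B(1)]) (rule inj_on_subset[OF bij_is_inj[OF \<psi>(2)] subset_UNIV])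
    moreover have "B \<approx> \<psi> ` B"
      using \<psi>(2) by (meson bij_betw_subset eqpoll_def subset_UNIV)
    ultimately show "same_dim s t"
      unfolding same_dim_def using B by blast
  }
qed

theorem proposition2p3:
  fixes sV :: "'k::field_char_0 \<Rightarrow> 'v::ab_group_add \<Rightarrow> 'v"
    and sW :: "'k \<Rightarrow> 'w::ab_group_add \<Rightarrow> 'w"
    and f :: "'v \<Rightarrow> 'k" and g :: "'w \<Rightarrow> 'k" and lam mu :: 'k
  assumes "vector_space sV" and "vector_space sW"
    and "Vector_Spaces.linear sV (*) f" and "Vector_Spaces.linear sW (*) g"
  shows "cpl_bialgebra_isomorphic (S_bialgebra sV f lam) (S_bialgebra sW g mu) \<longleftrightarrow>
    (f = (\<lambda>_. 0) \<and> g = (\<lambda>_. 0) \<and> same_dim sV sW) \<or>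
    (lam = mu \<and> (\<exists>\<psi>. Vector_Spaces.linear sV sW \<psi> \<and> bij \<psi> \<and> g \<circ> \<psi> = f))"
    (is "?iso \<longleftrightarrow> ?zero \<or> ?equal")
proof
  assume ?iso
  then obtain \<phi> where \<phi>: "cpl_bialgebra_iso (S_bialgebra sV f lam) (S_bialgebra sW g mu) \<phi>"
    by (auto simp: cpl_bialgebra_isomorphic_def)
  obtain \<psi> where \<psi>: "Vector_Spaces.linear sV sW \<psi>" "bij \<psi>"
    "\<And>v. \<phi> (sym_class sV (word [v])) = sym_class sW (word [\<psi> v])"
    using iso_on_letters[OF assms(1,2) \<phi>] by blast
  note parameters = iso_parameters[OF assms \<phi> \<psi>]
  show "?zero \<or> ?equal"
  proof (cases "f = (\<lambda>_. 0)")
    case True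
    have "g w = 0" for w
      using parameters(1) True \<psi>(2) by (metis bij_pointE comp_apply)
    then show ?thesis
      using True \<psi>(1,2) same_dim_iff[OF assms(1,2)] by blast
  next
    case False
    then show ?thesis using parameters \<psi>(1,2) by blast
  qed
next
  assume "?zero \<or> ?equal"
  then show ?iso
  proof
    assume ?equal
    then show ?iso
      unfolding cpl_bialgebra_isomorphic_def using iso_sym_map[OF _ _ assms(3,4)] by blast
  next
    assume zero: ?zero
    then obtain \<psi> where "Vector_Spaces.linear sV sW \<psi>" "bij \<psi>"
      using same_dim_iff[OF assms(1,2)] by blast
    then have "cpl_bialgebra_isomorphic (S_bialgebra sV f mu) (S_bialgebra sW g mu)"
      unfolding cpl_bialgebra_isomorphic_def using iso_sym_map[OF _ _ assms(3,4)] zero by fastforce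
    moreover have "letter_bullet f lam = letter_bullet f mu"
      using zero by (simp add: fun_eq_iff letter_bullet_eq)
    then have "S_bialgebra sV f lam = S_bialgebra sV f mu"
      by (simp add: S_bialgebra_def word_bullet_def[abs_def])
    ultimately show ?iso by simp
  qed
qed

end
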